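(* Let $q$ be a prime power and $n\ge 3$ an integer. There exist a $q$--covering design $\mathbb{C}_q(2n,3,2)$ in ${\rm PG}(2n-1,q)$ and a hyperplane $\Gamma$ of ${\rm PG}(2n-1,q)$ such that exactly $q^{2n-3}+\sum_{j=0}^{n-2}q^{2(n+j-1)}$ planes of the design are not contained in $\Gamma$ and exactly $(q+1)\left(\sum_{i=2}^{n-1}\left(q^{2i-3}+\sum_{j=0}^{i-2}q^{2(i+j-1)}\right)\right)-1$ planes of the design are contained in $\Gamma$.
   Context: For integers $n\ge k\ge r\ge 1$ and a prime power $q$, a $q$--covering design $\mathbb{C}_q(n,k,r)$ is a collection $\mathcal X$ of $(k-1)$--dimensional projective subspaces of ${\rm PG}(n-1,q)$ such that every $(r-1)$--dimensional projective subspace of ${\rm PG}(n-1,q)$ is contained in at least one element of $\mathcal X$. Thus a $\mathbb{C}_q(2n,3,2)$ is a set of planes of ${\rm PG}(2n-1,q)$ covering every line. *)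

theory Defs
  imports "HOL-Analysis.Analysis" "HOL-Number_Theory.Prime_Powers"
begin

text \<open>
  The projective space PG(N - 1, q) is the lattice of vector subspaces of the N-dimensional
  coordinate space \<open>'a ^ 'n\<close> over the finite field \<open>'a\<close>, where \<open>q = CARD('a)\<close> and
  \<open>N = CARD('n)\<close>. A projective subspace is represented by its underlying vector subspace, whose
  vector dimension exceeds the projective dimension \<open>d\<close> by one; incidence is inclusion.
\<close>

definition proj_subspace :: "nat \<Rightarrow> ('a::{field,finite} ^ 'n::finite) set \<Rightarrow> bool" where
  "proj_subspace d U \<longleftrightarrow> vec.subspace U \<and> vec.dim U = d + 1"

text \<open>
  Hyperplanes of PG(N - 1, q) have projective dimension N - 2. The dimension equation is stated
  without subtraction, so that there is no truncation for small N.
\<close>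

definition proj_hyperplane :: "('a::{field,finite} ^ 'n::finite) set \<Rightarrow> bool" where
  "proj_hyperplane \<Gamma> \<longleftrightarrow> (\<exists>d. d + 2 = CARD('n) \<and> proj_subspace d \<Gamma>)"

text \<open>
  The parameters \<open>N\<close> and \<open>q\<close> of a q-covering design are carried by the
  type of the ambient space; \<open>k\<close> and \<open>r\<close> are vector dimensions, whence the shift by one.
\<close>

definition q_covering_design ::
    "nat \<Rightarrow> nat \<Rightarrow> ('a::{field,finite} ^ 'n::finite) set set \<Rightarrow> bool" where
  "q_covering_design k r X \<longleftrightarrow>
     1 \<le> r \<and> r \<le> k \<and> k \<le> CARD('n) \<and>
     (\<forall>U\<in>X. proj_subspace (k - 1) U) \<and>
     (\<forall>W. proj_subspace (r - 1) W \<longrightarrow> (\<exists>U\<in>X. W \<subseteq> U))"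

end

theory Submission
  imports Defs "HOL-Algebra.Algebraic_Closure_Type" "HOL-Number_Theory.Residues"
begin

text \<open>
  The design is built by induction on \<open>n\<close>. Let \<open>\<Pi>\<close> have codimension 3 in the ambient space. A lifted
  maximum rank distance code, the graphs of \<open>k \<mapsto> \<alpha> k + \<beta> k\<^sup>q\<close> over an extension field, covers
  each line skew to \<open>\<Pi>\<close> once; any other line lies in \<open>\<langle>y, \<Pi>\<rangle>\<close> for some point \<open>y\<close> of the plane of
  cosets of \<open>\<Pi>\<close> and is covered there by induction.

  For \<open>n = 3\<close> put \<open>K = GF(q\<^sup>3)\<close>, write vectors as pairs \<open>(k, s)\<close> over \<open>K\<close> and let \<open>\<rho>\<close> be the plane
  \<open>k = 0\<close>. Taking all planes \<open>\<noteq> \<rho>\<close> of each solid \<open>\<langle>y, \<rho>\<rangle>\<close> through a point \<open>p\<^sub>y\<close> of \<open>\<rho>\<close> would put one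
  plane too many into the hyperplane. With \<open>cross x y = x y\<^sup>q - x\<^sup>q y\<close>, an alternating map with kernel
  \<open>\<langle>x\<rangle>\<close>, the set \<open>{(k, s). s \<in> cross k ` K}\<close> forms
  together with \<open>\<rho>\<close> a Klein quadric. The graphs with \<open>\<alpha> = - \<beta>\<^sup>q\<close> are
  the \<open>q\<^sup>3\<close> planes of the class not containing \<open>\<rho>\<close> that are disjoint from \<open>\<rho>\<close>. They are replaced by the
  \<open>q\<^sup>3 + q\<^sup>2 + q\<close> planes \<open>\<noteq> \<rho>\<close> of the class of \<open>\<rho>\<close>, which cover the same lines and in addition all
  lines but one of each plane \<open>\<langle>y\<rangle> + cross y ` K\<close>. Choosing \<open>p\<^sub>y\<close> in \<open>cross y ` K\<close>, that plane can be
  omitted in every solid \<open>\<langle>y, \<rho>\<rangle>\<close>, which saves \<open>q + 1\<close> planes of the hyperplane for \<open>q\<close> new ones.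

  Upper bounds on the two numbers of planes suffice, since arbitrary further planes may be added.
\<close>

no_notation Polynomials.var (\<open>X\<index>\<close>)

section \<open>Finite fields inside an algebraic closure\<close>

text \<open>The polynomial splits into a multiset of linear factors, and a factor occurring twice
  would make the derivative vanish at its root. So the multiset is a set of roots whose size is the
  degree.\<close>

lemma card_roots_separable:
  fixes p :: "'a :: alg_closed_field poly"
  assumes p0: "p \<noteq> 0" and sep: "\<And>x. poly p x = 0 \<Longrightarrow> poly (pderiv p) x \<noteq> 0"
  shows "card {x. poly p x = 0} = Polynomial.degree p"
proof -
  define c where "c = Polynomial.lead_coeff p"
  have c: "c \<noteq> 0" using p0 by (simp add: c_def)
  obtain A where sA: "size A = Polynomial.degree p"
    and pA: "p = Polynomial.smult c (\<Prod>x\<in>#A. [:-x, 1:])"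
    using alg_closed_imp_factorization[OF p0] unfolding c_def by blast
  have roots: "{x. poly p x = 0} = set_mset A"
    unfolding pA using c by (auto simp: poly_prod_mset image_iff)
  have "count A x = 1" if x: "x \<in># A" for x
  proof (rule ccontr)
    assume cnt: "count A x \<noteq> 1"
    obtain C where C: "A = add_mset x C" using x by (meson multi_member_split)
    with cnt have "x \<in># C" by (auto simp: not_in_iff)
    then obtain B where B: "C = add_mset x B" by (meson multi_member_split)
    define r where "r = (\<Prod>y\<in>#B. [:-y, 1:])"
    have "p = Polynomial.smult c ([:-x, 1:] * ([:-x, 1:] * r))"
      by (simp only: pA C B r_def image_mset_add_mset prod_mset.add_mset)
    then have "poly (pderiv p) x = 0"
      by (simp only: pderiv_smult pderiv_mult poly_smult poly_add poly_mult) simp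
    moreover have "poly p x = 0" using roots x by blast
    ultimately show False using sep by blast
  qed
  then have "A = mset_set (set_mset A)"
    by (intro multiset_eqI) (auto simp: count_mset_set' not_in_iff)
  then have "size A = card (set_mset A)" by (metis size_mset_set)
  then show ?thesis using sA roots by simp
qed

text \<open>Multiplication by a nonzero \<open>x\<close> permutes the nonzero elements, so it does
  not change their product.\<close>

lemma power_card_eq_same:
  fixes x :: "'a :: {field,finite}"
  shows "x ^ CARD('a) = x"
proof (cases "x = 0")
  case False
  have "x * (\<Prod>y\<in>UNIV-{0}. x * y) = x * x ^ (CARD('a) - 1) * \<Prod>(UNIV-{0})"
    by (simp add: prod.distrib mult_ac)
  also have "x * x ^ (CARD('a) - 1) = x ^ Suc (CARD('a) - 1)"
    by (subst power_Suc) auto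
  also have "Suc (CARD('a) - 1) = CARD('a)"
    using finite_UNIV_card_ge_0[where ?'a = 'a] by simp
  also have "(\<Prod>y\<in>UNIV-{0}. x * y) = (\<Prod>y\<in>UNIV-{0}. y)"
    by (rule prod.reindex_bij_witness[of _ "\<lambda>y. y / x" "\<lambda>y. x * y"]) (use False in auto)
  finally show ?thesis by simp
qed (use finite_UNIV_card_ge_0[where ?'a = 'a] in auto)

lemma prime_CHAR_finite: "Factorial_Ring.prime CHAR('a :: {field,finite})"
  using prime_CHAR_semidom[where ?'a = 'a] finite_imp_CHAR_pos[where ?'a = 'a] by simp

lemma CARD_eq_CHAR_power:
  assumes "primepow CARD('a :: {field,finite})"
  shows "\<exists>k>0. CARD('a) = CHAR('a) ^ k"
proof -
  from assms obtain p k where pk: "Factorial_Ring.prime p" "k > 0" "CARD('a) = p ^ k"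
    by (auto simp: primepow_def)
  have "CHAR('a) dvd p ^ k" using CHAR_dvd_CARD[where ?'a = 'a] pk by simp
  then have "CHAR('a) = p"
    using prime_CHAR_finite[where ?'a = 'a] pk(1)
    by (metis prime_dvd_power primes_dvd_imp_eq)
  with pk show ?thesis by auto
qed

abbreviation frob :: "'a::{field,finite} alg_closure \<Rightarrow> 'a alg_closure" where
  "frob x \<equiv> x ^ CARD('a)"

lemma frob_power_add:
  fixes x y :: "'a::{field,finite} alg_closure"
  assumes "primepow CARD('a)"
  shows "(x + y) ^ (CARD('a) ^ k) = x ^ (CARD('a) ^ k) + y ^ (CARD('a) ^ k)"
proof -
  obtain j where "CARD('a) = CHAR('a) ^ j" using CARD_eq_CHAR_power[OF assms] by blast
  then have "CARD('a) ^ k = CHAR('a alg_closure) ^ (j * k)" by (simp add: power_mult)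
  then show ?thesis
    using prime_CHAR_finite[where ?'a = 'a] by (intro freshmans_dream') auto
qed

lemma frob_add:
  fixes x y :: "'a::{field,finite} alg_closure"
  assumes "primepow CARD('a)"
  shows "frob (x + y) = frob x + frob y"
  using frob_power_add[OF assms, of x y 1] by simp

lemma to_ac_power_CARD [simp]: "to_ac (c :: 'a::{field,finite}) ^ CARD('a) = to_ac c"
  by (metis power_card_eq_same to_ac_power)

lemma to_ac_power_CARD_power [simp]: "to_ac (c :: 'a::{field,finite}) ^ (CARD('a) ^ k) = to_ac c"
  by (induction k) (simp_all add: power_mult)

lemma CARD_field_gt_1: "CARD('a :: {field,finite}) > 1"
proof -
  have "card {0, 1 :: 'a} \<le> CARD('a)" by (intro card_mono) auto
  then show ?thesis by simp
qed

text \<open>The polynomial X^q - X has at most q roots, and the q elements of the base field are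
  roots already.\<close>

lemma frob_fixed_imp_base:
  fixes x :: "'a::{field,finite} alg_closure"
  assumes "frob x = x"
  shows "x \<in> range to_ac"
proof -
  let ?q = "CARD('a)"
  define p :: "'a alg_closure poly" where "p = Polynomial.monom 1 ?q - Polynomial.monom 1 1"
  have q: "?q > 1" by (rule CARD_field_gt_1)
  have deg: "Polynomial.degree p = ?q"
    unfolding p_def using q by (subst diff_conv_add_uminus, subst degree_add_eq_left) (auto simp: Polynomial.degree_monom_eq)
  have p0: "p \<noteq> 0" using deg q by auto
  have "range to_ac \<subseteq> {x. poly p x = 0}" by (auto simp: p_def poly_monom)
  moreover have "card {x. poly p x = 0} \<le> card (range (to_ac :: 'a \<Rightarrow> _))"
    using card_poly_roots_bound[OF p0] by (simp add: deg card_image inj_to_ac)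
  ultimately have "range to_ac = {x. poly p x = 0}"
    by (intro card_seteq poly_roots_finite p0)
  then show ?thesis using assms by (auto simp: p_def poly_monom)
qed

text \<open>For \<open>N > 0\<close> this is GF(q^N), taken as the fixed field of the N-th power of
  Frobenius, so that the fields of all degrees are subsets of one type.\<close>

definition ext_field :: "nat \<Rightarrow> 'a::{field,finite} alg_closure set" where
  "ext_field N = {x. x ^ (CARD('a) ^ N) = x}"

text \<open>The derivative of X^(q^N) - X is -1, because q^N is divisible by the characteristic.
  Hence the polynomial has q^N distinct roots.\<close>

lemma card_ext_field:
  assumes "primepow CARD('a::{field,finite})" "N > 0"
  shows "card (ext_field N :: 'a alg_closure set) = CARD('a) ^ N"
proof -
  let ?Q = "CARD('a) ^ N"
  define p :: "'a alg_closure poly" where "p = Polynomial.monom 1 ?Q - Polynomial.monom 1 1"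
  have Q: "?Q > 1" using CARD_field_gt_1[where ?'a = 'a] assms(2) by (intro one_less_power) auto
  have deg: "Polynomial.degree p = ?Q"
    unfolding p_def using Q by (subst diff_conv_add_uminus, subst degree_add_eq_left) (auto simp: Polynomial.degree_monom_eq)
  obtain j where j: "j > 0" "CARD('a) = CHAR('a) ^ j" using CARD_eq_CHAR_power[OF assms(1)] by blast
  have "CHAR('a) dvd ?Q" using j assms(2) by (simp flip: power_mult)
  then have "of_nat ?Q = (0 :: 'a alg_closure)"
    by (simp only: of_nat_eq_0_iff_char_dvd CHAR_alg_closure)
  then have "pderiv p = - 1"
    by (simp only: p_def pderiv_diff pderiv_monom) (simp add: monom_0 one_pCons)
  moreover have "p \<noteq> 0" using deg Q by auto
  ultimately have "card {x. poly p x = 0} = ?Q"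
    using card_roots_separable[of p] by (simp add: deg)
  then show ?thesis by (simp add: ext_field_def p_def poly_monom)
qed

lemma finite_ext_field:
  assumes "primepow CARD('a::{field,finite})" "N > 0"
  shows "finite (ext_field N :: 'a alg_closure set)"
  using card_ext_field[OF assms] CARD_field_gt_1[where ?'a = 'a] by (intro card_ge_0_finite) simp

lemma ext_field_0 [simp]: "0 \<in> ext_field N"
  by (simp add: ext_field_def power_0_left)

lemma ext_field_add:
  assumes "primepow CARD('a::{field,finite})" "x \<in> ext_field N" "y \<in> ext_field N"
  shows "x + y \<in> (ext_field N :: 'a alg_closure set)"
  using assms frob_power_add[OF assms(1), of x y N] by (simp add: ext_field_def)

lemma ext_field_mult: "x \<in> ext_field N \<Longrightarrow> y \<in> ext_field N \<Longrightarrow> x * y \<in> ext_field N"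
  by (simp add: ext_field_def power_mult_distrib)

lemma ext_field_divide: "x \<in> ext_field N \<Longrightarrow> y \<in> ext_field N \<Longrightarrow> x / y \<in> ext_field N"
  by (simp add: ext_field_def power_divide)

lemma ext_field_power: "x \<in> ext_field N \<Longrightarrow> x ^ k \<in> ext_field N"
  by (simp add: ext_field_def) (metis power_mult mult.commute)

lemma ext_field_to_ac [simp]: "to_ac c \<in> ext_field N"
  by (simp add: ext_field_def)

lemma ext_field_minus: "x \<in> ext_field N \<Longrightarrow> - x \<in> ext_field N"
  using ext_field_mult[OF ext_field_to_ac[of "- 1"]] by fastforce

lemma ext_field_diff:
  assumes "primepow CARD('a::{field,finite})" "x \<in> ext_field N" "y \<in> ext_field N"
  shows "x - y \<in> (ext_field N :: 'a alg_closure set)"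
  using ext_field_add[OF assms(1,2) ext_field_minus[OF assms(3)]] by simp

global_interpretation ac: vector_space "\<lambda>(c :: 'a::field) (x :: 'a alg_closure). to_ac c * x"
  by unfold_locales (simp_all add: algebra_simps)

lemma ac_subspace_ext_field:
  assumes "primepow CARD('a::{field,finite})"
  shows "ac.subspace (ext_field N :: 'a alg_closure set)"
  by (rule ac.subspaceI) (auto intro: ext_field_add[OF assms] ext_field_mult)

section \<open>Planes and complements in coordinate space\<close>

lemma vec_span3: "vec.span {a, b, c :: 'a::field ^ 'n} = {x *s a + y *s b + z *s c | x y z. True}"
  (is "_ = ?R")
proof
  show "vec.span {a, b, c} \<subseteq> ?R"
  proof (rule vec.span_minimal)
    have "a = 1 *s a + 0 *s b + 0 *s c" "b = 0 *s a + 1 *s b + 0 *s c" "c = 0 *s a + 0 *s b + 1 *s c"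
      by simp_all
    then show "{a, b, c} \<subseteq> ?R" by blast
    show "vec.subspace ?R"
    proof (rule vec.subspaceI)
      have "0 = 0 *s a + 0 *s b + 0 *s c" by simp
      then show "0 \<in> ?R" by blast
    next
      fix u v assume "u \<in> ?R" "v \<in> ?R"
      then obtain x y z x' y' z' where "u = x *s a + y *s b + z *s c" "v = x' *s a + y' *s b + z' *s c"
        by blast
      then have "u + v = (x + x') *s a + (y + y') *s b + (z + z') *s c"
        by (simp add: vec.scale_left_distrib)
      then show "u + v \<in> ?R" by blast
    next
      fix r u assume "u \<in> ?R"
      then obtain x y z where "u = x *s a + y *s b + z *s c" by blast
      then have "r *s u = (r * x) *s a + (r * y) *s b + (r * z) *s c"
        by (simp add: vec.scale_right_distrib vector_smult_assoc)
      then show "r *s u \<in> ?R" by blast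
    qed
  qed
  show "?R \<subseteq> vec.span {a, b, c}"
  proof clarify
    fix x y z
    show "x *s a + y *s b + z *s c \<in> vec.span {a, b, c}"
      by (intro vec.span_add vec.span_scale) (auto intro: vec.span_base)
  qed
qed

lemma in_span3I:
  "v = x *s a + y *s b + z *s c \<Longrightarrow> v \<in> vec.span {a, b, c :: 'a::field ^ 'n}"
  unfolding vec_span3 by blast

text \<open>Independence of the family, not of the set \<open>{a, b, c}\<close>: in particular the
  three vectors are distinct.\<close>

definition indep3 :: "'a::field ^ 'n \<Rightarrow> 'a ^ 'n \<Rightarrow> 'a ^ 'n \<Rightarrow> bool" where
  "indep3 a b c \<longleftrightarrow> (\<forall>x y z. x *s a + y *s b + z *s c = 0 \<longrightarrow> x = 0 \<and> y = 0 \<and> z = 0)"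

lemma proj_plane_span3:
  fixes a b c :: "'a::{field,finite} ^ 'n::finite"
  assumes "indep3 a b c"
  shows "proj_subspace 2 (vec.span {a, b, c})"
proof -
  have *: "x = 0 \<and> y = 0 \<and> z = 0" if "x *s a + y *s b + z *s c = 0" for x y z
    using assms that by (auto simp: indep3_def)
  have c: "c \<noteq> 0" using *[of 0 0 1] by auto
  have b: "b \<notin> vec.span {c}"
  proof
    assume "b \<in> vec.span {c}"
    then obtain k where "b = k *s c" by (auto simp: vec.span_singleton)
    then show False using *[of 0 1 "- k"] by simp
  qed
  have a: "a \<notin> vec.span {b, c}"
  proof
    assume "a \<in> vec.span {b, c}"
    then obtain k l where "a - k *s b = l *s c"
      by (auto simp: vec.span_breakdown_eq[of _ b] vec.span_singleton)
    then have "a = k *s b + l *s c" by (simp add: algebra_simps)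
    then show False using *[of 1 "- k" "- l"] by (simp add: algebra_simps)
  qed
  have "vec.independent {a, b, c}"
    using a b c by (intro vec.independent_insertI vec.independent_empty) auto
  moreover have "a \<noteq> b" "a \<noteq> c" "b \<noteq> c" using a b by (auto simp: vec.span_base)
  ultimately have "vec.dim {a, b, c} = 3" by (subst vec.dim_eq_card_independent) auto
  then show ?thesis by (simp add: proj_subspace_def vec.subspace_span)
qed

text \<open>Each vector of the larger span is in a unique way a multiple of \<open>b\<close> plus a
  vector of \<open>span B\<close>. The scalar multiplication is a parameter because the count serves
  both the coordinate space and the algebraic closure.\<close>

lemma card_span_independent:
  fixes scale :: "'a::{field,finite} \<Rightarrow> 'b::ab_group_add \<Rightarrow> 'b"
  assumes "vector_space scale" "finite B" "\<not> module.dependent scale B"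
  shows "card (module.span scale B) = CARD('a) ^ card B"
  using assms(2,3)
proof (induction B rule: finite_induct)
  interpret vector_space scale by fact
  case empty
  then show ?case by simp
next
  interpret vector_space scale by fact
  case (insert b B)
  have b: "b \<notin> span B" and B: "independent B"
    using insert.prems insert.hyps by (auto simp: independent_insert)
  let ?f = "\<lambda>(c, v). scale c b + v"
  have inj: "inj_on ?f (UNIV \<times> span B)"
  proof (intro inj_onI, clarify)
    fix c v d w assume vw: "v \<in> span B" "w \<in> span B" and eq: "scale c b + v = scale d b + w"
    then have "scale (c - d) b = w - v" by (simp add: scale_left_diff_distrib algebra_simps)
    then have "scale (c - d) b \<in> span B" using vw by (simp add: span_diff)
    then have "c = d" using b
      by (metis right_minus_eq scale_scale scale_one left_inverse span_scale)
    then show "c = d \<and> v = w" using eq by simp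
  qed
  have "span (insert b B) = ?f ` (UNIV \<times> span B)"
  proof (intro equalityI subsetI)
    fix x assume "x \<in> span (insert b B)"
    then obtain k where "x - scale k b \<in> span B" by (auto simp: span_breakdown_eq)
    then show "x \<in> ?f ` (UNIV \<times> span B)"
      by (intro image_eqI[of _ _ "(k, x - scale k b)"]) auto
  next
    fix x assume "x \<in> ?f ` (UNIV \<times> span B)"
    then obtain c v where v: "x = scale c b + v" "v \<in> span B" by auto
    have "v \<in> span (insert b B)" using v(2) span_mono[of B "insert b B"] by blast
    then show "x \<in> span (insert b B)"
      unfolding v(1) by (intro span_add span_scale) (auto intro: span_base)
  qed
  then show ?case
    using insert.IH[OF B] insert.hyps inj by (simp add: card_image card_cartesian_product)
qed

lemma card_subspace:
  fixes U :: "('a::{field,finite} ^ 'n::finite) set"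
  assumes "vec.subspace U"
  shows "card U = CARD('a) ^ vec.dim U"
proof -
  obtain B where B: "B \<subseteq> U" "vec.independent B" "U \<subseteq> vec.span B" "card B = vec.dim U"
    using vec.basis_exists by blast
  have "vec.span B = U" using B assms by (simp add: vec.span_minimal subset_antisym)
  moreover have "vector_space ((*s) :: 'a \<Rightarrow> 'a ^ 'n \<Rightarrow> _)" by unfold_locales
  ultimately show ?thesis using card_span_independent[of "(*s)" B] B by simp
qed

section \<open>Linear maps from GF(q^N) to the coordinate space\<close>

global_interpretation ac_vec: vector_space_pair
  "\<lambda>(c :: 'a::{field,finite}) (x :: 'a alg_closure). to_ac c * x" "(*s) :: 'a \<Rightarrow> 'a ^ 'n::finite \<Rightarrow> 'a ^ 'n"
  by unfold_locales

text \<open>Linear on the whole closure, so that no membership premises arise; injectivity is only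
  ever claimed on \<open>ext_field N\<close>.\<close>

definition ac_linear :: "('a::{field,finite} alg_closure \<Rightarrow> 'a ^ 'n::finite) \<Rightarrow> bool" where
  "ac_linear f \<longleftrightarrow> (\<forall>x y. f (x + y) = f x + f y) \<and> (\<forall>c x. f (to_ac c * x) = c *s f x)"

lemma ac_linear_add: "ac_linear f \<Longrightarrow> f (x + y) = f x + f y"
  and ac_linear_scale: "ac_linear f \<Longrightarrow> f (to_ac c * x) = c *s f x"
  by (simp_all add: ac_linear_def)

lemma ac_linear_0: "ac_linear f \<Longrightarrow> f 0 = 0"
  using ac_linear_scale[of f 0 0] by simp

lemma ac_linear_minus: "ac_linear f \<Longrightarrow> f (- x) = - f x"
  using ac_linear_scale[of f "- 1" x] by simp

lemma ac_linear_exists: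
  fixes g :: "'a::{field,finite} alg_closure \<Rightarrow> 'a ^ 'n::finite"
  assumes "ac.independent B"
  shows "\<exists>f. ac_linear f \<and> (\<forall>b\<in>B. f b = g b) \<and> range f = vec.span (g ` B)"
proof -
  let ?f = "ac_vec.construct B g"
  interpret f: Vector_Spaces.linear "\<lambda>(c :: 'a) (x :: 'a alg_closure). to_ac c * x" "(*s)" ?f
    by (rule ac_vec.linear_construct[OF assms])
  have "ac_linear ?f" by (simp add: ac_linear_def f.add f.scale)
  then show ?thesis
    using ac_vec.construct_basis[OF assms] ac_vec.range_construct_eq_span[OF assms, of g] by blast
qed

text \<open>Identifies \<open>P\<close> with GF(q^N), so that field multiplication and Frobenius
  become available on \<open>P\<close>. Counting elements shows that a basis of the field has
  \<open>N\<close> elements; it is sent to a basis of \<open>P\<close>, and injectivity follows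
  since both sets have q^N elements.\<close>

lemma ext_field_parametrisation:
  fixes P :: "('a::{field,finite} ^ 'n::finite) set"
  assumes pp: "primepow CARD('a)" and P: "vec.subspace P" "vec.dim P = N" and N: "N > 0"
  obtains \<phi> :: "'a alg_closure \<Rightarrow> 'a ^ 'n" where "ac_linear \<phi>" "\<phi> ` ext_field N = P"
    "\<And>x. x \<in> ext_field N \<Longrightarrow> \<phi> x = 0 \<Longrightarrow> x = 0"
proof -
  let ?K = "ext_field N :: 'a alg_closure set"
  have vs: "vector_space (\<lambda>(c :: 'a) (x :: 'a alg_closure). to_ac c * x)" by unfold_locales
  note finK = finite_ext_field[OF pp N]
  obtain B where B: "B \<subseteq> ?K" "ac.independent B" "?K \<subseteq> ac.span B"
    using ac.maximal_independent_subset by blast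
  have spanB: "ac.span B = ?K"
    using B ac_subspace_ext_field[OF pp] by (simp add: ac.span_minimal subset_antisym)
  have finB: "finite B" using B finK finite_subset by blast
  have "CARD('a) ^ card B = CARD('a) ^ N"
    using card_span_independent[OF vs finB B(2)] spanB card_ext_field[OF pp N] by simp
  then have cB: "card B = N" using CARD_field_gt_1[where ?'a = 'a] by (simp add: power_inject_exp)
  obtain C where C: "C \<subseteq> P" "vec.independent C" "P \<subseteq> vec.span C" "card C = N"
    using vec.basis_exists[of P] P by metis
  have spanC: "vec.span C = P" using C P by (simp add: vec.span_minimal subset_antisym)
  obtain g where g: "bij_betw g B C"
    using finite_same_card_bij[OF finB _ ] C cB by (metis finite)
  obtain \<phi> where \<phi>: "ac_linear \<phi>" "\<forall>b\<in>B. \<phi> b = g b"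
    using ac_linear_exists[OF B(2), of g] by blast
  interpret f: Vector_Spaces.linear "\<lambda>(c :: 'a) (x :: 'a alg_closure). to_ac c * x" "(*s)" \<phi>
    by unfold_locales (simp_all add: ac_linear_add[OF \<phi>(1)] ac_linear_scale[OF \<phi>(1)])
  have "\<phi> ` B = C" using g \<phi>(2) by (auto simp: bij_betw_def)
  then have im: "\<phi> ` ?K = P"
    using f.span_image[of B] spanB spanC by simp
  have "card P = card ?K" using card_subspace[OF P(1)] P(2) card_ext_field[OF pp N] by simp
  then have inj: "inj_on \<phi> ?K" using im finK by (simp add: eq_card_imp_inj_on)
  show thesis
    using \<phi>(1) im inj_onD[OF inj, of _ 0] ac_linear_0[OF \<phi>(1)] by (intro that) auto
qed

section \<open>Complements of subspaces and graphs over them\<close>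

lemma subspace_split1:
  fixes U :: "('a::{field,finite} ^ 'n::finite) set"
  assumes "vec.subspace U" "vec.dim U = Suc k"
  obtains P w where "vec.subspace P" "vec.dim P = k" "P \<subseteq> U" "w \<in> U" "w \<notin> P"
    "\<And>v. v \<in> U \<Longrightarrow> \<exists>a. v - a *s w \<in> P"
proof -
  obtain B where B: "B \<subseteq> U" "vec.independent B" "U \<subseteq> vec.span B" "card B = Suc k"
    using vec.basis_exists[of U] assms by metis
  have spanB: "vec.span B = U" using B assms by (simp add: vec.span_minimal subset_antisym)
  obtain w C where wC: "B = insert w C" "w \<notin> C" using B(4) by (metis card_Suc_eq)
  have C: "vec.independent C" "card C = k" "w \<notin> vec.span C"
    using B wC vec.independent_insert[of w C] by auto
  show thesis
  proof (rule that[of "vec.span C" w])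
    show "vec.dim (vec.span C) = k" using C by (simp add: vec.dim_eq_card_independent)
    show "vec.span C \<subseteq> U" using spanB wC vec.span_mono[of C B] by auto
    show "w \<in> U" using B wC by auto
    show "\<exists>a. v - a *s w \<in> vec.span C" if "v \<in> U" for v
      using that spanB wC by (auto simp: vec.span_breakdown_eq)
  qed (use C in \<open>auto simp: vec.subspace_span\<close>)
qed

text \<open>Linear independence of the three cosets in the quotient by \<open>P\<close>.\<close>

definition indep_mod :: "('a::field ^ 'n) set \<Rightarrow> 'a ^ 'n \<Rightarrow> 'a ^ 'n \<Rightarrow> 'a ^ 'n \<Rightarrow> bool" where
  "indep_mod P u v w \<longleftrightarrow> (\<forall>a b c. a *s u + b *s v + c *s w \<in> P \<longrightarrow> a = 0 \<and> b = 0 \<and> c = 0)"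

lemma subspace_scale_cancel:
  fixes U :: "('a::field ^ 'n::finite) set"
  assumes "vec.subspace U" "c *s v \<in> U" "v \<notin> U"
  shows "c = 0"
proof (rule ccontr)
  assume "c \<noteq> 0"
  then have "v = inverse c *s (c *s v)" by (simp add: vector_smult_assoc)
  then show False using assms vec.subspace_scale by metis
qed

text \<open>\<open>P\<close> has codimension 2 in \<open>U\<close>, hence 3 in the span of
  \<open>U\<close> and a vector \<open>x\<close> outside. \<open>P\<close>, \<open>w1\<close> and
  \<open>w2\<close> are chosen before \<open>x\<close>, so the same coordinates inside
  \<open>U\<close> serve all \<open>x\<close>.\<close>

lemma subspace_split2:
  fixes U :: "('a::{field,finite} ^ 'n::finite) set"
  assumes U: "vec.subspace U" "vec.dim U = k + 2"
  obtains P w1 w2 where "vec.subspace P" "vec.dim P = k" "P \<subseteq> U" "w1 \<in> U" "w2 \<in> U"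
    "\<And>v. v \<in> U \<Longrightarrow> \<exists>a b. v - a *s w1 - b *s w2 \<in> P"
    "\<And>x. x \<notin> U \<Longrightarrow> indep_mod P w1 w2 x"
proof -
  obtain U1 w1 where 1: "vec.subspace U1" "vec.dim U1 = Suc k" "U1 \<subseteq> U" "w1 \<in> U" "w1 \<notin> U1"
    "\<And>v. v \<in> U \<Longrightarrow> \<exists>a. v - a *s w1 \<in> U1"
    using subspace_split1[OF U(1), of "Suc k"] U(2) by auto
  obtain P w2 where 2: "vec.subspace P" "vec.dim P = k" "P \<subseteq> U1" "w2 \<in> U1" "w2 \<notin> P"
    "\<And>v. v \<in> U1 \<Longrightarrow> \<exists>a. v - a *s w2 \<in> P"
    using subspace_split1[OF 1(1,2)] by auto
  show thesis
  proof (rule that[of P w1 w2])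
    show "\<exists>a b. v - a *s w1 - b *s w2 \<in> P" if "v \<in> U" for v
      using 1(6)[OF that] 2(6) by blast
    show "indep_mod P w1 w2 x" if x: "x \<notin> U" for x
      unfolding indep_mod_def
    proof (intro allI impI)
      fix a b c assume *: "a *s w1 + b *s w2 + c *s x \<in> P"
      have wU: "a *s w1 + b *s w2 \<in> U"
        using 1 2 U by (auto intro!: vec.subspace_add vec.subspace_scale)
      have "c *s x \<in> U"
        using vec.subspace_diff[OF U(1) _ wU, of "a *s w1 + b *s w2 + c *s x"] * 1(3) 2(3) by auto
      then have c: "c = 0" using subspace_scale_cancel[OF U(1)] x by blast
      have "b *s w2 \<in> U1" using 1(1) 2(4) by (rule vec.subspace_scale)
      then have "a *s w1 \<in> U1"
        using vec.subspace_diff[OF 1(1), of "a *s w1 + b *s w2" "b *s w2"] * c 2(3) by auto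
      then have a: "a = 0" using subspace_scale_cancel[OF 1(1)] 1(5) by blast
      have "b *s w2 \<in> P" using * a c by simp
      then show "a = 0 \<and> b = 0 \<and> c = 0" using a c subspace_scale_cancel[OF 2(1)] 2(5) by blast
    qed
  qed (use 1 2 in auto)
qed

text \<open>The three vectors generate the graph of a linear map from the span of \<open>u\<close>,
  \<open>v\<close>, \<open>w\<close> to \<open>P\<close>. A relation between them, read modulo
  \<open>P\<close>, is a relation between cosets and hence trivial.\<close>

lemma indep_mod_graph:
  fixes P :: "('a::{field,finite} ^ 'n::finite) set"
  assumes "indep_mod P u v w" "vec.subspace P" "p \<in> P" "p' \<in> P" "p'' \<in> P"
  shows "indep3 (u + p) (v + p') (w + p'')"
  unfolding indep3_def
proof (intro allI impI)
  fix a b c assume "a *s (u + p) + b *s (v + p') + c *s (w + p'') = 0"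
  then have "a *s u + b *s v + c *s w = - (a *s p + b *s p' + c *s p'')"
    by (simp add: vec.scale_right_distrib add_eq_0_iff algebra_simps)
  also have "\<dots> \<in> P" using assms by (intro vec.subspace_neg vec.subspace_add vec.subspace_scale)
  finally show "a = 0 \<and> b = 0 \<and> c = 0" using assms(1) by (auto simp: indep_mod_def)
qed

text \<open>The map can be recovered from its graph: \<open>u + p\<close> is the only vector of the
  span that is congruent to \<open>u\<close> modulo \<open>P\<close>. This yields many distinct
  planes.\<close>

lemma indep_mod_graph_inj:
  fixes P :: "('a::{field,finite} ^ 'n::finite) set"
  assumes im: "indep_mod P u v w" and P: "vec.subspace P"
  shows "inj_on (\<lambda>(p, p', p''). vec.span {u + p, v + p', w + p''}) (P \<times> P \<times> P)"
proof -
  have key: "a = 1 \<and> b = 0 \<and> c = 0 \<and> r = p" if "u + r = a *s (u + p) + b *s (v + p') + c *s (w + p'')"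
    "r \<in> P" "p \<in> P" "p' \<in> P" "p'' \<in> P" "indep_mod P u v w"
    for u v w p p' p'' r a b c
  proof -
    from that(1) have "(a - 1) *s u + b *s v + c *s w = r - (a *s p + b *s p' + c *s p'')"
      by (simp add: vec.scale_right_distrib vec.scale_left_diff_distrib algebra_simps)
    also have "\<dots> \<in> P" using that P by (intro vec.subspace_diff vec.subspace_add vec.subspace_scale)
    finally have "a - 1 = 0 \<and> b = 0 \<and> c = 0" using that(6) unfolding indep_mod_def by blast
    then show ?thesis using that(1) by simp
  qed
  \<comment> \<open>The recovery works alike for each generator, so it is applied to permuted
    triples.\<close>
  have sw: "indep_mod P v u w" "indep_mod P w v u"
    using im unfolding indep_mod_def by (metis add.commute, metis add.commute add.left_commute)
  show ?thesis
  proof (rule inj_onI)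
    fix S T assume ST: "S \<in> P \<times> P \<times> P" "T \<in> P \<times> P \<times> P"
      "(\<lambda>(p, p', p''). vec.span {u + p, v + p', w + p''}) S = (\<lambda>(p, p', p''). vec.span {u + p, v + p', w + p''}) T"
    obtain p p' p'' r r' r'' where S: "S = (p, p', p'')" and T: "T = (r, r', r'')"
      by (meson prod_cases3)
    have P': "p \<in> P" "p' \<in> P" "p'' \<in> P" "r \<in> P" "r' \<in> P" "r'' \<in> P"
      and eq: "vec.span {u + p, v + p', w + p''} = vec.span {u + r, v + r', w + r''}"
      using ST by (auto simp: S T)
    have "u + r \<in> vec.span {u + p, v + p', w + p''}" "v + r' \<in> vec.span {v + p', u + p, w + p''}"
      "w + r'' \<in> vec.span {w + p'', v + p', u + p}"
      by (simp_all add: eq insert_commute vec.span_base)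
    then obtain a b c a' b' c' a'' b'' c'' where
      "u + r = a *s (u + p) + b *s (v + p') + c *s (w + p'')"
      "v + r' = a' *s (v + p') + b' *s (u + p) + c' *s (w + p'')"
      "w + r'' = a'' *s (w + p'') + b'' *s (v + p') + c'' *s (u + p)"
      unfolding vec_span3 by (elim CollectE exE conjE)
    from key[OF this(1)] key[OF this(2)] key[OF this(3)] P' im sw
    show "S = T" unfolding S T by simp
  qed
qed

section \<open>The cross product and linearised polynomials\<close>

text \<open>The Moore determinant, that is, the determinant of the matrix with rows (x, x^q) and (y,
  y^q).\<close>

definition cross :: "'a::{field,finite} alg_closure \<Rightarrow> 'a alg_closure \<Rightarrow> 'a alg_closure" where
  "cross x y = x * frob y - frob x * y"

lemma cross_self [simp]: "cross x x = 0"
  by (simp add: cross_def)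

lemma cross_0 [simp]: "cross 0 x = 0" "cross x 0 = (0 :: 'a::{field,finite} alg_closure)"
  using CARD_field_gt_1[where ?'a = 'a] by (simp_all add: cross_def power_0_left)

lemma cross_swap: "cross y x = - cross x y"
  by (simp add: cross_def)

lemma cross_add:
  assumes "primepow CARD('a::{field,finite})"
  shows "cross (x + y :: 'a alg_closure) z = cross x z + cross y z"
    and "cross z (x + y) = cross z x + cross z y"
  by (simp_all add: cross_def frob_add[OF assms] algebra_simps)

lemma cross_scale:
  "cross (to_ac c * x) y = to_ac c * cross x y"
  "cross x (to_ac c * y) = to_ac c * cross x y"
  by (simp_all add: cross_def power_mult_distrib algebra_simps)

lemma cross_ext_field:
  assumes "primepow CARD('a::{field,finite})" "x \<in> ext_field N" "y \<in> ext_field N"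
  shows "cross x y \<in> (ext_field N :: 'a alg_closure set)"
  unfolding cross_def using assms by (intro ext_field_diff ext_field_mult ext_field_power)

text \<open>A vanishing determinant means that \<open>x / y\<close> is fixed by Frobenius, hence
  lies in the base field.\<close>

lemma cross_eq_0_imp:
  assumes "cross x y = 0" "y \<noteq> 0"
  shows "\<exists>c. x = to_ac c * y"
proof -
  have "frob (x / y) = x / y"
    using assms by (simp add: cross_def power_divide field_simps)
  then obtain c where "x / y = to_ac c" using frob_fixed_imp_base by blast
  then show ?thesis using assms(2) by (auto simp: field_simps)
qed

text \<open>Cramer's rule: the values prescribed at \<open>k\<close> and \<open>l\<close> give a
  linear system for \<open>\<alpha>\<close> and \<open>\<beta>\<close> with determinant
  \<open>cross k l\<close>. This is why the graphs of these maps reach every line skew to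
  \<open>P\<close>.\<close>

lemma linearised_interpolation:
  fixes k l s t :: "'a::{field,finite} alg_closure"
  assumes pp: "primepow CARD('a)"
    and K: "k \<in> ext_field N" "l \<in> ext_field N" "s \<in> ext_field N" "t \<in> ext_field N"
    and D: "cross k l \<noteq> 0"
  obtains \<alpha> \<beta> where "\<alpha> \<in> ext_field N" "\<beta> \<in> ext_field N"
    "\<alpha> * k + \<beta> * frob k = s" "\<alpha> * l + \<beta> * frob l = t"
proof
  let ?\<alpha> = "(s * frob l - t * frob k) / cross k l" and ?\<beta> = "(k * t - l * s) / cross k l"
  show "?\<alpha> \<in> ext_field N" "?\<beta> \<in> ext_field N"
    using K by (auto intro!: ext_field_divide cross_ext_field ext_field_diff ext_field_mult ext_field_power pp)
  have "?\<alpha> * k + ?\<beta> * frob k = s * cross k l / cross k l"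
    unfolding cross_def by (simp add: add_divide_distrib[symmetric] algebra_simps)
  then show "?\<alpha> * k + ?\<beta> * frob k = s" using D by simp
  have "?\<alpha> * l + ?\<beta> * frob l = t * cross k l / cross k l"
    unfolding cross_def by (simp add: add_divide_distrib[symmetric] algebra_simps)
  then show "?\<alpha> * l + ?\<beta> * frob l = t" using D by simp
qed

definition ac_comb :: "'a::field alg_closure \<Rightarrow> 'a alg_closure \<Rightarrow> 'a alg_closure \<Rightarrow> 'a \<Rightarrow> 'a \<Rightarrow> 'a \<Rightarrow> 'a alg_closure" where
  "ac_comb x y z a b c = to_ac a * x + to_ac b * y + to_ac c * z"

definition ac_indep3 :: "'a::field alg_closure \<Rightarrow> 'a alg_closure \<Rightarrow> 'a alg_closure \<Rightarrow> bool" where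
  "ac_indep3 x y z \<longleftrightarrow> (\<forall>a b c. ac_comb x y z a b c = 0 \<longrightarrow> a = 0 \<and> b = 0 \<and> c = 0)"

lemma ac_comb_minus:
  "ac_comb x y z a b c - ac_comb x y z a' b' c' = ac_comb x y z (a - a') (b - b') (c - c')"
  by (simp add: ac_comb_def algebra_simps)

lemma ac_indep3_eqD:
  assumes "ac_indep3 x y z" "ac_comb x y z a b c = ac_comb x y z a' b' c'"
  shows "a = a' \<and> b = b' \<and> c = c'"
proof -
  have "ac_comb x y z (a - a') (b - b') (c - c') = 0"
    using assms(2) ac_comb_minus[of x y z a b c a' b' c'] by simp
  then have "a - a' = 0 \<and> b - b' = 0 \<and> c - c' = 0" using assms(1) unfolding ac_indep3_def by blast
  then show ?thesis by simp
qed

lemma ac_comb_ext_field: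
  assumes "primepow CARD('a::{field,finite})" "x \<in> ext_field N" "y \<in> ext_field N" "z \<in> ext_field N"
  shows "ac_comb x y z a b c \<in> (ext_field N :: 'a alg_closure set)"
  unfolding ac_comb_def using assms by (intro ext_field_add ext_field_mult ext_field_to_ac)

text \<open>The at most q^2 combinations of \<open>x\<close> and \<open>y\<close> cannot exhaust the
  q^N elements of the field when \<open>N \<ge> 3\<close>.\<close>

lemma ac_indep3_extend:
  assumes pp: "primepow CARD('a::{field,finite})" and N: "N \<ge> 3" and "x \<noteq> 0" "y \<notin> range (\<lambda>a. to_ac a * x)"
  shows "\<exists>z\<in>ext_field N. ac_indep3 (x :: 'a alg_closure) y z"
proof -
  let ?E = "(\<lambda>(a, b). to_ac a * x + to_ac b * y) ` UNIV"
  have "card ?E \<le> CARD('a \<times> 'a)" by (rule card_image_le) simp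
  also have "\<dots> = CARD('a) ^ 2" by (simp add: power2_eq_square)
  also have "\<dots> < card (ext_field N :: 'a alg_closure set)"
    using N CARD_field_gt_1[where ?'a = 'a] by (simp add: card_ext_field[OF pp])
  finally have "\<not> ext_field N \<subseteq> ?E" using card_mono[of ?E "ext_field N"] by auto
  then obtain z where z: "z \<in> ext_field N" "z \<notin> ?E" by blast
  have "ac_indep3 x y z"
    unfolding ac_indep3_def ac_comb_def
  proof (intro allI impI)
    fix a b c assume *: "to_ac a * x + to_ac b * y + to_ac c * z = 0"
    have c: "c = 0"
    proof (rule ccontr)
      assume "c \<noteq> 0"
      with * have "z = to_ac (- a / c) * x + to_ac (- b / c) * y"
        by (simp add: field_simps eq_neg_iff_add_eq_0)
      then show False using z(2) image_eqI[of z "\<lambda>(a, b). to_ac a * x + to_ac b * y" "(- a / c, - b / c)"]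
        by simp
    qed
    have b: "b = 0"
    proof (rule ccontr)
      assume "b \<noteq> 0"
      with * c have "y = to_ac (- a / b) * x" by (simp add: field_simps eq_neg_iff_add_eq_0)
      then show False using assms(4) by blast
    qed
    show "a = 0 \<and> b = 0 \<and> c = 0" using * b c assms(3) by simp
  qed
  then show ?thesis using z by blast
qed

lemma ac_indep3_exists:
  assumes pp: "primepow CARD('a::{field,finite})" and N: "N \<ge> 3"
  obtains x y z where "x \<in> ext_field N" "y \<in> ext_field N" "z \<in> ext_field N" "ac_indep3 (x :: 'a alg_closure) y z"
proof -
  have x: "(1 :: 'a alg_closure) \<in> ext_field N" using ext_field_to_ac[of "1 :: 'a"] by simp
  have "card (range (\<lambda>a :: 'a. to_ac a * 1)) \<le> CARD('a) ^ 1" 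
    using card_image_le[of "UNIV :: 'a set" "\<lambda>a. to_ac a * 1"] by simp
  also have "\<dots> < card (ext_field N :: 'a alg_closure set)"
    using N CARD_field_gt_1[where ?'a = 'a] power_strict_increasing[of 1 N "CARD('a)"]
    by (simp add: card_ext_field[OF pp])
  finally have "\<not> ext_field N \<subseteq> range (\<lambda>a :: 'a. to_ac a * 1)"
    using card_mono[of "range (\<lambda>a :: 'a. to_ac a * 1)" "ext_field N"] by auto
  then obtain y :: "'a alg_closure" where y: "y \<in> ext_field N" "y \<notin> range (\<lambda>a. to_ac a * 1)" by blast
  obtain z where "z \<in> ext_field N" "ac_indep3 1 y z"
    using ac_indep3_extend[OF pp N _ y(2)] by auto
  then show thesis using that x y(1) by blast
qed

text \<open>In degree 3 the q^3 combinations are pairwise distinct and therefore fill the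
  field.\<close>

lemma ac_indep3_span:
  assumes pp: "primepow CARD('a::{field,finite})"
    and K: "x \<in> ext_field 3" "y \<in> ext_field 3" "z \<in> ext_field 3" and ind: "ac_indep3 (x :: 'a alg_closure) y z"
    and k: "k \<in> ext_field 3"
  obtains a b c where "k = ac_comb x y z a b c"
proof -
  let ?f = "\<lambda>(a, b, c). ac_comb x y z a b c"
  have "inj ?f" using ac_indep3_eqD[OF ind] by (auto simp: inj_on_def)
  then have "card (range ?f) = CARD('a \<times> 'a \<times> 'a)" by (rule card_image)
  also have "\<dots> = card (ext_field 3 :: 'a alg_closure set)"
    by (simp add: card_ext_field[OF pp] eval_nat_numeral)
  finally have "range ?f = ext_field 3"
    using ac_comb_ext_field[OF pp K] by (intro card_subset_eq finite_ext_field[OF pp]) auto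
  then show thesis using k that by (metis (mono_tags, lifting) case_prod_conv imageE surj_pair)
qed

lemma ac_linear_exists3:
  fixes x y z :: "'a::{field,finite} alg_closure" and u v w :: "'a ^ 'n::finite"
  assumes ind: "ac_indep3 x y z"
  obtains f where "ac_linear f" "f x = u" "f y = v" "f z = w"
proof -
  have *: "a = 0 \<and> b = 0 \<and> c = 0" if "to_ac a * x + to_ac b * y + to_ac c * z = 0" for a b c
    using ind that by (auto simp: ac_indep3_def ac_comb_def)
  have z: "z \<noteq> 0" using *[of 0 0 1] by auto
  have y: "y \<notin> ac.span {z}"
  proof
    assume "y \<in> ac.span {z}"
    then obtain k where "y = to_ac k * z" by (auto simp: ac.span_singleton)
    then show False using *[of 0 1 "- k"] by simp
  qed
  have x: "x \<notin> ac.span {y, z}"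
  proof
    assume "x \<in> ac.span {y, z}"
    then obtain k l where "x - to_ac k * y = to_ac l * z"
      by (auto simp: ac.span_breakdown_eq[of _ y] ac.span_singleton)
    then have "x = to_ac k * y + to_ac l * z" by (simp add: algebra_simps)
    then show False using *[of 1 "- k" "- l"] by (simp add: algebra_simps)
  qed
  have ind': "ac.independent {x, y, z}"
    using x y z by (intro ac.independent_insertI ac.independent_empty) auto
  have ne: "x \<noteq> y" "x \<noteq> z" "y \<noteq> z" using x y by (auto simp: ac.span_base)
  obtain f where "ac_linear f" "\<forall>b\<in>{x, y, z}. f b = (if b = x then u else if b = y then v else w)"
    using ac_linear_exists[OF ind', of "\<lambda>b. if b = x then u else if b = y then v else w"] by blast
  then show thesis using that ne by auto
qed

lemma ac_linear_comb:
  assumes "ac_linear f"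
  shows "f (ac_comb x y z a b c) = a *s f x + b *s f y + c *s f z"
  by (simp add: ac_comb_def ac_linear_add[OF assms] ac_linear_scale[OF assms])

section \<open>Covering systems and the two counts\<close>

text \<open>Pairs of vectors replace lines, since a subspace contains a line as soon as it contains
  two vectors spanning it. Dependent pairs are included, so that no independence has to be carried
  along.\<close>

definition covers :: "'b set set \<Rightarrow> 'b set \<Rightarrow> bool" where
  "covers F U \<longleftrightarrow> (\<forall>u\<in>U. \<forall>v\<in>U. \<exists>E\<in>F. u \<in> E \<and> v \<in> E)"

text \<open>\<open>aff_count q n\<close> and \<open>inf_count q n\<close> are the two numbers of the
  theorem: the planes not contained in the hyperplane and the planes contained in it.\<close>

definition aff_count :: "nat \<Rightarrow> nat \<Rightarrow> nat" where
  "aff_count q i = q ^ (2 * i - 3) + (\<Sum>j = 0..i - 2. q ^ (2 * (i + j - 1)))"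

definition inf_count :: "nat \<Rightarrow> nat \<Rightarrow> nat" where
  "inf_count q n = (q + 1) * (\<Sum>i = 2..n - 1. aff_count q i) - 1"

text \<open>
  The planes \<open>B\<close> inside the hyperplane \<open>H\<close> do not depend on the point \<open>x\<close> that spans the
  ambient space together with \<open>H\<close>; this lets the systems on all hyperplanes through a
  common \<open>H\<close> share \<open>B\<close>.
\<close>

definition coverable :: "nat \<Rightarrow> ('a::{field,finite} ^ 'n::finite) set \<Rightarrow> bool" where
  "coverable m H \<longleftrightarrow> (\<exists>B. card B \<le> inf_count CARD('a) m \<and> (\<forall>E\<in>B. proj_subspace 2 E \<and> E \<subseteq> H) \<and>
     (\<forall>x. x \<notin> H \<longrightarrow> (\<exists>A. card A \<le> aff_count CARD('a) m \<and>
        (\<forall>E\<in>A. proj_subspace 2 E \<and> E \<subseteq> vec.span (insert x H) \<and> \<not> E \<subseteq> H) \<and>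
        covers (A \<union> B) (vec.span (insert x H)))))"

text \<open>The first summand is the number of pairs \<open>(\<alpha>, \<beta>)\<close> over
  GF(q^(2m - 1)), the second counts one smaller system for each of the q^2 affine points.\<close>

lemma aff_count_Suc:
  assumes "m \<ge> 2"
  shows "aff_count q (Suc m) = q ^ (2 * (2 * m - 1)) + q ^ 2 * aff_count q m"
proof -
  obtain k where m: "m = k + 2" using assms by (metis add.commute le_Suc_ex)
  have "(\<Sum>j = 0..Suc k. q ^ (2 * (k + 2 + j))) = (\<Sum>j = 0..k. q ^ (2 * (k + 2 + j))) + q ^ (4 * k + 6)"
    by (simp only: sum.atLeast0_atMost_Suc, intro arg_cong2[of _ _ _ _ "(+)"] arg_cong[of _ _ "\<lambda>k. q ^ k"]) auto
  moreover have "(\<Sum>j = 0..k. q ^ (2 * (k + 2 + j))) = q ^ 2 * (\<Sum>j = 0..k. q ^ (2 * (k + 1 + j)))"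
    unfolding sum_distrib_left
    by (intro sum.cong refl) (simp only: power_add[symmetric], rule arg_cong[of _ _ "\<lambda>k. q ^ k"], simp)
  moreover have "q ^ (2 * k + 3) = q ^ 2 * q ^ (2 * k + 1)"
    by (simp only: power_add[symmetric], rule arg_cong[of _ _ "\<lambda>k. q ^ k"], simp)
  moreover have "aff_count q (Suc m) = q ^ (2 * k + 3) + (\<Sum>j = 0..Suc k. q ^ (2 * (k + 2 + j)))"
    unfolding aff_count_def m by (intro arg_cong2[of _ _ _ _ "(+)"] sum.cong arg_cong[of _ _ "\<lambda>k. q ^ k"]) auto
  moreover have "aff_count q m = q ^ (2 * k + 1) + (\<Sum>j = 0..k. q ^ (2 * (k + 1 + j)))"
    unfolding aff_count_def m by (intro arg_cong2[of _ _ _ _ "(+)"] sum.cong arg_cong[of _ _ "\<lambda>k. q ^ k"]) auto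
  moreover have "2 * (2 * m - 1) = 4 * k + 6" by (simp add: m)
  ultimately show ?thesis by (simp only: distrib_left add_ac)
qed

lemma aff_count_pos: "q > 0 \<Longrightarrow> aff_count q m > 0"
  by (simp add: aff_count_def)

text \<open>Each of the q + 1 points at infinity contributes \<open>aff_count q m\<close> planes,
  while the planes inside the smaller hyperplane are shared by all points and counted once. For
  \<open>m \<ge> 3\<close> the sum is positive, so the truncated subtraction of 1 is a genuine
  one.\<close>

lemma inf_count_Suc:
  assumes "m \<ge> 3" "q > 0"
  shows "inf_count q (Suc m) = (q + 1) * aff_count q m + inf_count q m"
proof -
  have "{2..m} = insert m {2..m - 1}" using assms by auto
  then have "(\<Sum>i = 2..m. aff_count q i) = aff_count q m + (\<Sum>i = 2..m - 1. aff_count q i)"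
    using assms by simp
  moreover have "(\<Sum>i = 2..m - 1. aff_count q i) > 0"
    using assms by (intro sum_pos aff_count_pos) auto
  ultimately show ?thesis by (simp add: inf_count_def algebra_simps)
qed

text \<open>For independent \<open>u\<close>, \<open>v\<close>, \<open>w\<close> these are
  normalised representatives of the points of the projective plane they span: here the q^2 points
  off the line on \<open>u\<close> and \<open>v\<close>, in \<open>inf_points\<close> the q + 1
  points on it.\<close>

definition aff_points :: "'a::{field,finite} ^ 'n \<Rightarrow> 'a ^ 'n \<Rightarrow> 'a ^ 'n \<Rightarrow> ('a ^ 'n) set" where
  "aff_points u v w = (\<lambda>(a, b). a *s u + b *s v + w) ` UNIV"

definition inf_points :: "'a::{field,finite} ^ 'n \<Rightarrow> 'a ^ 'n \<Rightarrow> ('a ^ 'n) set" where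
  "inf_points u v = insert v ((\<lambda>a. u + a *s v) ` UNIV)"

lemma card_aff_points: "card (aff_points u v (w :: 'a::{field,finite} ^ 'n)) \<le> CARD('a) ^ 2"
  using card_image_le[of "UNIV :: ('a \<times> 'a) set" "\<lambda>(a, b). a *s u + b *s v + w"]
  by (simp add: aff_points_def power2_eq_square)

lemma card_inf_points: "card (inf_points u (v :: 'a::{field,finite} ^ 'n)) \<le> CARD('a) + 1"
proof -
  have "card ((\<lambda>a. u + a *s v) ` UNIV) \<le> CARD('a)" by (rule card_image_le) simp
  then show ?thesis by (auto simp: inf_points_def card_insert_if intro: le_SucI)
qed

lemma points_normalise:
  fixes u v w :: "'a::{field,finite} ^ 'n"
  assumes "\<not> (a = 0 \<and> b = 0 \<and> c = 0)"
  obtains y d where "y \<in> aff_points u v w \<union> inf_points u v" "d \<noteq> 0" "a *s u + b *s v + c *s w = d *s y"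
proof (cases "c = 0")
  case False
  have "(a / c) *s u + (b / c) *s v + w \<in> aff_points u v w"
    unfolding aff_points_def by (rule image_eqI[of _ _ "(a / c, b / c)"]) auto
  then show thesis using False by (intro that[of _ c]) (auto simp: vec.scale_right_distrib vector_smult_assoc)
next
  case c: True
  show thesis
  proof (cases "a = 0")
    case False
    have "u + (b / a) *s v \<in> inf_points u v" by (auto simp: inf_points_def)
    then show thesis using False c by (intro that[of _ a]) (auto simp: vec.scale_right_distrib vector_smult_assoc)
  next
    case True
    then show thesis using c assms by (intro that[of v b]) (auto simp: inf_points_def)
  qed
qed

section \<open>The inductive step\<close>

lemma linearised_comb:
  assumes "primepow CARD('a::{field,finite})"
  shows "\<alpha> * ac_comb x y z a b c + \<beta> * frob (ac_comb x y z a b c :: 'a alg_closure)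
    = ac_comb (\<alpha> * x + \<beta> * frob x) (\<alpha> * y + \<beta> * frob y) (\<alpha> * z + \<beta> * frob z) a b c"
  by (simp add: ac_comb_def frob_add[OF assms] power_mult_distrib algebra_simps)

text \<open>The coordinates of two vectors are carried over to the closure, where a vanishing
  \<open>cross\<close> means proportionality over the base field. The two vectors are then multiples
  of one normalised point.\<close>

lemma proportional_common_point:
  fixes u v w :: "'a::{field,finite} ^ 'n"
  assumes ind: "ac_indep3 x y z" and cr: "cross (ac_comb x y z a b c) (ac_comb x y z a' b' c') = 0"
  obtains p d d' where "p \<in> aff_points u v w \<union> inf_points u v"
    "a *s u + b *s v + c *s w = d *s p" "a' *s u + b' *s v + c' *s w = d' *s p"
proof (cases "a' = 0 \<and> b' = 0 \<and> c' = 0")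
  case True
  show thesis
  proof (cases "a = 0 \<and> b = 0 \<and> c = 0")
    case 0: True
    show thesis using True 0 by (intro that[of v 0 0]) (auto simp: inf_points_def)
  next
    case False
    obtain p d where "p \<in> aff_points u v w \<union> inf_points u v" "a *s u + b *s v + c *s w = d *s p"
      using points_normalise[OF False, of u v w] by metis
    then show thesis using True by (intro that[of p d 0]) auto
  qed
next
  case False
  then have "ac_comb x y z a' b' c' \<noteq> 0" using ind by (auto simp: ac_indep3_def)
  then obtain e where "ac_comb x y z a b c = to_ac e * ac_comb x y z a' b' c'"
    using cross_eq_0_imp[OF cr] by blast
  also have "\<dots> = ac_comb x y z (e * a') (e * b') (e * c')" by (simp add: ac_comb_def algebra_simps)
  finally have e: "a = e * a'" "b = e * b'" "c = e * c'" using ac_indep3_eqD[OF ind] by blast+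
  obtain p d where p: "p \<in> aff_points u v w \<union> inf_points u v" "a' *s u + b' *s v + c' *s w = d *s p"
    using points_normalise[OF False, of u v w] by metis
  have "a *s u + b *s v + c *s w = e *s (a' *s u + b' *s v + c' *s w)"
    by (simp add: e vec.scale_right_distrib vector_smult_assoc)
  also have "\<dots> = (e * d) *s p" by (simp add: p vector_smult_assoc)
  finally show thesis using p by (intro that[of p "e * d" d]) auto
qed

lemma span_insert_subspace:
  assumes "vec.subspace P"
  shows "v \<in> vec.span (insert y P) \<longleftrightarrow> (\<exists>d. v - d *s y \<in> P)"
  by (simp add: vec.span_breakdown_eq vec.span_eq_iff[THEN iffD2, OF assms])

lemma split_decomposition:
  assumes P: "vec.subspace P" and H: "vec.subspace H"
    and split: "\<And>v. v \<in> H \<Longrightarrow> \<exists>a b. v - a *s w1 - b *s w2 \<in> P"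
    and u: "u \<in> vec.span (insert x H)"
  obtains a b c p where "p \<in> P" "u = a *s w1 + b *s w2 + c *s x + p"
proof -
  obtain c where "u - c *s x \<in> H" using u span_insert_subspace[OF H] by blast
  then obtain a b where "u - c *s x - a *s w1 - b *s w2 \<in> P" using split by blast
  then show thesis by (rule that) (simp add: algebra_simps)
qed

text \<open>A vector of \<open>H\<close> in the span of \<open>y\<close> and \<open>P\<close> has no
  \<open>y\<close> component. Hence a plane of that span which is not contained in \<open>P\<close>
  is not contained in \<open>H\<close> either.\<close>

lemma span_insert_meet:
  assumes P: "vec.subspace P" and H: "vec.subspace H" "P \<subseteq> H" and y: "y \<notin> H"
    and e: "e \<in> vec.span (insert y P)" "e \<in> H"
  shows "e \<in> P"
proof -
  obtain d where d: "e - d *s y \<in> P" using e span_insert_subspace[OF P] by blast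
  then have "d *s y \<in> H" using vec.subspace_diff[OF H(1) e(2), of "e - d *s y"] H(2) by auto
  then have "d = 0" using subspace_scale_cancel[OF H(1)] y by blast
  then show ?thesis using d by simp
qed

lemma aff_points_notin:
  assumes H: "vec.subspace H" "w1 \<in> H" "w2 \<in> H" "x \<notin> H" and y: "y \<in> aff_points w1 w2 x"
  shows "y \<notin> H" "y \<in> vec.span (insert x H)"
proof -
  obtain a b where y: "y = a *s w1 + b *s w2 + x" using y by (auto simp: aff_points_def)
  have *: "a *s w1 + b *s w2 \<in> H" using H by (intro vec.subspace_add vec.subspace_scale)
  show "y \<notin> H"
  proof
    assume "y \<in> H"
    then have "y - (a *s w1 + b *s w2) \<in> H" using * H by (intro vec.subspace_diff)
    then show False using y H by simp
  qed
  have "y - 1 *s x \<in> H" using * y by simp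
  then show "y \<in> vec.span (insert x H)" using span_insert_subspace[OF H(1)] by blast
qed

lemma inf_points_in:
  assumes "vec.subspace H" "w1 \<in> H" "w2 \<in> H" "y \<in> inf_points w1 w2"
  shows "y \<in> H"
  using assms by (auto simp: inf_points_def intro!: vec.subspace_add vec.subspace_scale)

lemma points_notin_mod:
  assumes "indep_mod P w1 w2 x" "y \<in> aff_points w1 w2 x \<union> inf_points w1 w2"
  shows "y \<notin> P"
proof -
  consider a b where "y = a *s w1 + b *s w2 + 1 *s x" | a where "y = 1 *s w1 + a *s w2 + 0 *s x"
    | "y = 0 *s w1 + 1 *s w2 + 0 *s x"
    using assms(2) by (auto simp: aff_points_def inf_points_def)
  then show ?thesis using assms(1) unfolding indep_mod_def by cases (metis zero_neq_one)+
qed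

lemma card_UN_bound:
  assumes "card I \<le> k" "finite I" "\<And>i. i \<in> I \<Longrightarrow> card (F i) \<le> l"
  shows "card (\<Union> (F ` I)) \<le> k * l"
proof -
  have "card (\<Union> (F ` I)) \<le> (\<Sum>i\<in>I. card (F i))" using assms(2) by (rule card_UN_le)
  also have "\<dots> \<le> card I * l" using sum_bounded_above[of I "\<lambda>i. card (F i)" l] assms(3) by simp
  also have "\<dots> \<le> k * l" using assms(1) by simp
  finally show ?thesis .
qed

text \<open>The graph of \<open>k \<mapsto> \<phi> (\<alpha> * k + \<beta> * frob k)\<close> over
  the plane on \<open>u\<close>, \<open>v\<close>, \<open>w\<close>, where \<open>u\<close>,
  \<open>v\<close>, \<open>w\<close> stand for the field elements \<open>x\<close>,
  \<open>y\<close>, \<open>z\<close>.\<close>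

definition graph_plane :: "('a::{field,finite} alg_closure \<Rightarrow> 'a ^ 'n) \<Rightarrow> 'a ^ 'n \<Rightarrow> 'a ^ 'n \<Rightarrow> 'a ^ 'n \<Rightarrow>
    'a alg_closure \<Rightarrow> 'a alg_closure \<Rightarrow> 'a alg_closure \<Rightarrow> 'a alg_closure \<Rightarrow> 'a alg_closure \<Rightarrow> ('a ^ 'n) set" where
  "graph_plane \<phi> u v w x y z \<alpha> \<beta> = vec.span {u + \<phi> (\<alpha> * x + \<beta> * frob x), v + \<phi> (\<alpha> * y + \<beta> * frob y),
      w + \<phi> (\<alpha> * z + \<beta> * frob z)}"

lemma graph_plane_contains:
  fixes \<phi> :: "'a::{field,finite} alg_closure \<Rightarrow> 'a ^ 'n"
  assumes pp: "primepow CARD('a)" and \<phi>: "ac_linear \<phi>"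
    and s: "\<alpha> * ac_comb x y z a b c + \<beta> * frob (ac_comb x y z a b c) = s"
  shows "a *s u + b *s v + c *s w + \<phi> s \<in> graph_plane \<phi> u v w x y z \<alpha> \<beta>"
  unfolding graph_plane_def
  by (rule in_span3I[of _ a _ b _ c])
    (simp only: s[symmetric] linearised_comb[OF pp] ac_linear_comb[OF \<phi>] vec.scale_right_distrib add_ac)

lemma graph_plane_plane:
  fixes \<phi> :: "'a::{field,finite} alg_closure \<Rightarrow> 'a ^ 'n::finite"
  assumes pp: "primepow CARD('a)" and im: "indep_mod P u v w" and P: "vec.subspace P"
    and \<phi>: "\<phi> ` ext_field N \<subseteq> P" and K: "x \<in> ext_field N" "y \<in> ext_field N" "z \<in> ext_field N"
    and ab: "\<alpha> \<in> ext_field N" "\<beta> \<in> ext_field N"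
    and H: "vec.subspace H" "P \<subseteq> H" "u \<in> H" "v \<in> H" "w \<notin> H"
  shows "proj_subspace 2 (graph_plane \<phi> u v w x y z \<alpha> \<beta>)"
    and "graph_plane \<phi> u v w x y z \<alpha> \<beta> \<subseteq> vec.span (insert w H)"
    and "\<not> graph_plane \<phi> u v w x y z \<alpha> \<beta> \<subseteq> H"
proof -
  have lin: "\<phi> (\<alpha> * k + \<beta> * frob k) \<in> P" if "k \<in> ext_field N" for k
    using \<phi> that ab by (intro subsetD[OF \<phi>] imageI ext_field_add pp ext_field_mult ext_field_power)
  show "proj_subspace 2 (graph_plane \<phi> u v w x y z \<alpha> \<beta>)"
    unfolding graph_plane_def using K by (intro proj_plane_span3 indep_mod_graph[OF im P] lin)
  have HS: "H \<subseteq> vec.span (insert w H)" by (auto intro: vec.span_base)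
  have "w \<in> vec.span (insert w H)" by (simp add: vec.span_base)
  then show "graph_plane \<phi> u v w x y z \<alpha> \<beta> \<subseteq> vec.span (insert w H)"
    unfolding graph_plane_def using lin[OF K(1)] lin[OF K(2)] lin[OF K(3)] H HS
    by (intro vec.span_minimal vec.subspace_span) (auto intro!: vec.span_add)
  have "w + \<phi> (\<alpha> * z + \<beta> * frob z) \<in> graph_plane \<phi> u v w x y z \<alpha> \<beta>"
    unfolding graph_plane_def by (simp add: vec.span_base)
  moreover have "w + \<phi> (\<alpha> * z + \<beta> * frob z) \<notin> H"
    using vec.subspace_diff[OF H(1), of "w + \<phi> (\<alpha> * z + \<beta> * frob z)" "\<phi> (\<alpha> * z + \<beta> * frob z)"]
      lin[OF K(3)] H by auto
  ultimately show "\<not> graph_plane \<phi> u v w x y z \<alpha> \<beta> \<subseteq> H" by blast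
qed

lemma coverable_step:
  fixes H :: "('a::{field,finite} ^ 'n::finite) set"
  assumes pp: "primepow CARD('a)" and m: "m \<ge> 3"
    and IH: "\<And>P :: ('a ^ 'n) set. vec.subspace P \<Longrightarrow> vec.dim P = 2 * m - 1 \<Longrightarrow> coverable m P"
    and H: "vec.subspace H" "vec.dim H = 2 * m + 1"
  shows "coverable (Suc m) H"
proof -
  let ?q = "CARD('a)"
  define N where "N = 2 * m - 1"
  have N: "N \<ge> 3" "N > 0" using m by (auto simp: N_def)
  have "vec.dim H = N + 2" using H(2) m by (simp add: N_def)
  then obtain P w1 w2 where P: "vec.subspace P" "vec.dim P = N" "P \<subseteq> H" and w: "w1 \<in> H" "w2 \<in> H"
    and split: "\<And>v. v \<in> H \<Longrightarrow> \<exists>a b. v - a *s w1 - b *s w2 \<in> P"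
    and im: "\<And>x. x \<notin> H \<Longrightarrow> indep_mod P w1 w2 x"
    using subspace_split2[OF H(1)] by metis
  obtain \<phi> :: "'a alg_closure \<Rightarrow> 'a ^ 'n" where \<phi>: "ac_linear \<phi>" "\<phi> ` ext_field N = P"
    using ext_field_parametrisation[OF pp P(1,2) N(2)] by metis
  \<comment> \<open>Here \<open>N \<ge> 5\<close>, so \<open>x1\<close>, \<open>x2\<close>,
    \<open>x3\<close> span only a 3-dimensional subspace of GF(q^N). The linearised polynomials are
    restricted to it, which does not affect interpolation at two arguments.\<close>
  obtain x1 x2 x3 :: "'a alg_closure" where K: "x1 \<in> ext_field N" "x2 \<in> ext_field N" "x3 \<in> ext_field N"
    and ind: "ac_indep3 x1 x2 x3" using ac_indep3_exists[OF pp N(1)] by metis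
  have "coverable m P" using IH P by (simp add: N_def)
  then obtain B A where B: "card B \<le> inf_count ?q m" "\<And>E. E \<in> B \<Longrightarrow> proj_subspace 2 E \<and> E \<subseteq> P"
    and A: "\<And>y. y \<notin> P \<Longrightarrow> card (A y) \<le> aff_count ?q m"
      "\<And>y E. y \<notin> P \<Longrightarrow> E \<in> A y \<Longrightarrow> proj_subspace 2 E \<and> E \<subseteq> vec.span (insert y P) \<and> \<not> E \<subseteq> P"
      "\<And>y. y \<notin> P \<Longrightarrow> covers (A y \<union> B) (vec.span (insert y P))"
    unfolding coverable_def by metis
  \<comment> \<open>Points of \<open>P\<close> are removed because \<open>A y\<close> is controlled
    only for \<open>y\<close> outside \<open>P\<close>, and the independence of \<open>w1\<close>,
    \<open>w2\<close> modulo \<open>P\<close> is known here only once some \<open>x\<close> outside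
    \<open>H\<close> is given.\<close>
  define B' where "B' = B \<union> \<Union> (A ` (inf_points w1 w2 - P))"
  define G where "G x = graph_plane \<phi> w1 w2 x x1 x2 x3" for x
  define A' where "A' x = (\<lambda>(\<alpha>, \<beta>). G x \<alpha> \<beta>) ` (ext_field N \<times> ext_field N) \<union> \<Union> (A ` aff_points w1 w2 x)" for x
  have span_le: "vec.span (insert y P) \<subseteq> U" if "vec.subspace U" "y \<in> U" "P \<subseteq> U" for y U
    using that by (intro vec.span_minimal) auto
  have cK: "card (ext_field N :: 'a alg_closure set) = ?q ^ (2 * m - 1)"
    using card_ext_field[OF pp N(2)] by (simp add: N_def)
  have HS: "H \<subseteq> vec.span (insert x H)" for x by (auto intro: vec.span_base)
  show ?thesis
    unfolding coverable_def
  proof (rule exI[of _ B'], intro conjI ballI allI impI)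
    have "card (\<Union> (A ` (inf_points w1 w2 - P))) \<le> (?q + 1) * aff_count ?q m"
      using card_inf_points[of w1 w2] card_mono[of "inf_points w1 w2" "inf_points w1 w2 - P"]
      by (intro card_UN_bound A(1)) auto
    then have "card B' \<le> inf_count ?q m + (?q + 1) * aff_count ?q m"
      using card_Un_le[of B "\<Union> (A ` (inf_points w1 w2 - P))"] B(1) unfolding B'_def by linarith
    then show "card B' \<le> inf_count ?q (Suc m)" using inf_count_Suc[OF m] by simp
  next
    fix E assume E: "E \<in> B'"
    have "proj_subspace 2 E \<and> E \<subseteq> H"
    proof (cases "E \<in> B")
      case True
      then show ?thesis using B(2) P(3) by blast
    next
      case False
      then obtain y where "y \<in> inf_points w1 w2" "y \<notin> P" "E \<in> A y" using E by (auto simp: B'_def)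
      then show ?thesis using A(2) span_le[OF H(1) inf_points_in[OF H(1) w] P(3)] by blast
    qed
    then show "proj_subspace 2 E" "E \<subseteq> H" by auto
  next
    fix x assume x: "x \<notin> H"
    have yP: "y \<notin> P" if "y \<in> aff_points w1 w2 x \<union> inf_points w1 w2" for y
      using points_notin_mod[OF im[OF x] that] .
    show "\<exists>A. card A \<le> aff_count ?q (Suc m) \<and>
        (\<forall>E\<in>A. proj_subspace 2 E \<and> E \<subseteq> vec.span (insert x H) \<and> \<not> E \<subseteq> H) \<and>
        covers (A \<union> B') (vec.span (insert x H))"
    proof (intro exI[of _ "A' x"] conjI ballI)
      have "card ((\<lambda>(\<alpha>, \<beta>). G x \<alpha> \<beta>) ` (ext_field N \<times> ext_field N)) \<le> card ((ext_field N :: 'a alg_closure set) \<times> (ext_field N :: 'a alg_closure set))"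
        by (intro card_image_le finite_cartesian_product finite_ext_field pp N)
      also have "\<dots> = ?q ^ (2 * (2 * m - 1))"
        by (simp only: card_cartesian_product cK mult_2[of "2 * m - 1"] power_add)
      finally have "card ((\<lambda>(\<alpha>, \<beta>). G x \<alpha> \<beta>) ` (ext_field N \<times> ext_field N)) \<le> ?q ^ (2 * (2 * m - 1))" .
      moreover have "card (\<Union> (A ` aff_points w1 w2 x)) \<le> ?q ^ 2 * aff_count ?q m"
        using card_aff_points[of w1 w2 x] yP by (intro card_UN_bound A(1)) auto
      ultimately have "card (A' x) \<le> ?q ^ (2 * (2 * m - 1)) + ?q ^ 2 * aff_count ?q m"
        using card_Un_le[of "(\<lambda>(\<alpha>, \<beta>). G x \<alpha> \<beta>) ` (ext_field N \<times> ext_field N)" "\<Union> (A ` aff_points w1 w2 x)"]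
        unfolding A'_def by linarith
      then show "card (A' x) \<le> aff_count ?q (Suc m)" using aff_count_Suc m by simp
    next
      fix E assume E: "E \<in> A' x"
      have "proj_subspace 2 E \<and> E \<subseteq> vec.span (insert x H) \<and> \<not> E \<subseteq> H"
      proof (cases "E \<in> \<Union> (A ` aff_points w1 w2 x)")
        case True
        then obtain y where y: "y \<in> aff_points w1 w2 x" "E \<in> A y" by blast
        then have E': "proj_subspace 2 E" "E \<subseteq> vec.span (insert y P)" "\<not> E \<subseteq> P" using A(2) yP by blast+
        note yH = aff_points_notin[OF H(1) w x y(1)]
        have "E \<subseteq> vec.span (insert x H)"
          using E'(2) span_le[OF vec.subspace_span yH(2)] P(3) HS by blast
        moreover have "\<not> E \<subseteq> H" using span_insert_meet[OF P(1) H(1) P(3) yH(1)] E'(2,3) by blast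
        ultimately show ?thesis using E'(1) by blast
      next
        case False
        then obtain \<alpha> \<beta> where ab: "\<alpha> \<in> ext_field N" "\<beta> \<in> ext_field N" and EG: "E = G x \<alpha> \<beta>"
          using E by (auto simp: A'_def)
        show ?thesis
          unfolding EG G_def
          using graph_plane_plane[OF pp im[OF x] P(1) equalityD1[OF \<phi>(2)] K ab H(1) P(3) w x] by blast
      qed
      then show "proj_subspace 2 E" "E \<subseteq> vec.span (insert x H)" "\<not> E \<subseteq> H" by auto
    next
      show "covers (A' x \<union> B') (vec.span (insert x H))"
        unfolding covers_def
      proof (intro ballI)
        fix u v assume uv: "u \<in> vec.span (insert x H)" "v \<in> vec.span (insert x H)"
        obtain a b c p where u: "p \<in> P" "u = a *s w1 + b *s w2 + c *s x + p"
          using split_decomposition[OF P(1) H(1) split uv(1)] by metis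
        obtain a' b' c' p' where v: "p' \<in> P" "v = a' *s w1 + b' *s w2 + c' *s x + p'"
          using split_decomposition[OF P(1) H(1) split uv(2)] by metis
        let ?k = "ac_comb x1 x2 x3 a b c" and ?l = "ac_comb x1 x2 x3 a' b' c'"
        show "\<exists>E\<in>A' x \<union> B'. u \<in> E \<and> v \<in> E"
        \<comment> \<open>If \<open>cross\<close> vanishes, \<open>u\<close> and \<open>v\<close>
          are dependent modulo \<open>P\<close>, so both lie in the span of \<open>P\<close> and one
          point, where the smaller system applies. Otherwise interpolation yields a graph through
          both.\<close>
        proof (cases "cross ?k ?l = 0")
          case True
          obtain y d d' where y: "y \<in> aff_points w1 w2 x \<union> inf_points w1 w2"
            and d: "a *s w1 + b *s w2 + c *s x = d *s y" "a' *s w1 + b' *s w2 + c' *s x = d' *s y"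
            using proportional_common_point[OF ind True, of w1 w2 x] by metis
          have "u - d *s y \<in> P" "v - d' *s y \<in> P" using u v d by simp_all
          then have "u \<in> vec.span (insert y P)" "v \<in> vec.span (insert y P)"
            using span_insert_subspace[OF P(1)] by blast+
          then obtain E where "E \<in> A y \<union> B" "u \<in> E" "v \<in> E"
            using A(3)[OF yP[OF y]] unfolding covers_def by blast
          moreover have "A y \<union> B \<subseteq> A' x \<union> B'"
            using y yP[OF y] unfolding A'_def B'_def by blast
          ultimately show ?thesis by blast
        next
          case False
          obtain s t where st: "s \<in> ext_field N" "t \<in> ext_field N" "\<phi> s = p" "\<phi> t = p'"
            using \<phi>(2) u(1) v(1) by blast
          obtain \<alpha> \<beta> where ab: "\<alpha> \<in> ext_field N" "\<beta> \<in> ext_field N"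
            "\<alpha> * ?k + \<beta> * frob ?k = s" "\<alpha> * ?l + \<beta> * frob ?l = t"
            using linearised_interpolation[OF pp ac_comb_ext_field[OF pp K] ac_comb_ext_field[OF pp K] st(1,2) False]
            by metis
          have "u \<in> G x \<alpha> \<beta>" "v \<in> G x \<alpha> \<beta>"
            unfolding G_def u(2) v(2) st(3,4)[symmetric]
            using graph_plane_contains[OF pp \<phi>(1)] ab(3,4) by blast+
          moreover have "G x \<alpha> \<beta> \<in> A' x" using ab unfolding A'_def by blast
          ultimately show ?thesis by blast
        qed
      qed
    qed
  qed
qed

section \<open>The six-dimensional case\<close>

text \<open>Let \<rho> be spanned by independent \<open>p\<close>, \<open>Q\<close>,
  \<open>r\<close>, and let \<open>y\<close> lie outside. These are the q^2 + q - 1 planes through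
  \<open>p\<close> in the solid \<langle>y, \<rho>\<rangle> other than \<rho> and \<langle>y, p,
  Q\<rangle>. The first family meets \<rho> in the line \<langle>p, Q\<rangle>, the second in the
  other q lines through \<open>p\<close>.\<close>

definition flag_planes :: "'a::{field,finite} ^ 'n \<Rightarrow> 'a ^ 'n \<Rightarrow> 'a ^ 'n \<Rightarrow> 'a ^ 'n \<Rightarrow> ('a ^ 'n) set set" where
  "flag_planes y p Q r = (\<lambda>c. vec.span {y + c *s r, p, Q}) ` (UNIV - {0}) \<union>
     (\<lambda>(c, t). vec.span {y + c *s Q, p, r + t *s Q}) ` UNIV"

lemma card_flag_planes:
  "card (flag_planes y p Q (r :: 'a::{field,finite} ^ 'n)) \<le> (CARD('a) - 1) + CARD('a) ^ 2"
proof -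
  have "card ((\<lambda>c. vec.span {y + c *s r, p, Q}) ` (UNIV - {0})) \<le> card (UNIV - {0 :: 'a})"
    by (rule card_image_le) simp
  moreover have "card ((\<lambda>(c, t). vec.span {y + c *s Q, p, r + t *s Q}) ` UNIV) \<le> CARD('a \<times> 'a)"
    by (rule card_image_le) simp
  ultimately show ?thesis
    unfolding flag_planes_def by (intro card_Un_le[THEN le_trans] add_mono) (auto simp: power2_eq_square)
qed

context
  fixes P :: "('a::{field,finite} ^ 'n::finite) set" and y p Q r :: "'a ^ 'n"
  assumes P: "P = vec.span {p, Q, r}" and ind: "indep3 p Q r" and y: "y \<notin> P"
begin

lemma pencil_base_subspace: "vec.subspace P"
  unfolding P by (rule vec.subspace_span)

lemma pencil_base_mem: "p \<in> P" "Q \<in> P" "r \<in> P"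
  unfolding P by (auto intro: vec.span_base)

lemma flag_planes_planes:
  assumes "E \<in> flag_planes y p Q r"
  shows "proj_subspace 2 E" "E \<subseteq> vec.span (insert y P)" "\<not> E \<subseteq> P"
proof -
  have ind': "a = 0 \<and> b = 0 \<and> c = 0" if "a *s p + b *s Q + c *s r = 0" for a b c
    using ind that unfolding indep3_def by blast
  \<comment> \<open>Both families consist of planes spanned by a translate \<open>y + s\<close> and
    a line of \<open>P\<close>.\<close>
  have gen: "proj_subspace 2 E \<and> E \<subseteq> vec.span (insert y P) \<and> \<not> E \<subseteq> P"
    if E: "E = vec.span {y + s, g, h}" and s: "s \<in> P" "g \<in> P" "h \<in> P"
      and gh: "\<And>a b. a *s g + b *s h = 0 \<Longrightarrow> a = 0 \<and> b = 0" for s g h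
  proof (intro conjI)
    have "indep3 (y + s) g h"
      unfolding indep3_def
    proof (intro allI impI)
      fix a b c assume *: "a *s (y + s) + b *s g + c *s h = 0"
      then have "a *s y = - (a *s s + b *s g + c *s h)"
        by (simp add: vec.scale_right_distrib add_eq_0_iff algebra_simps)
      also have "\<dots> \<in> P" using s pencil_base_subspace by (intro vec.subspace_neg vec.subspace_add vec.subspace_scale)
      finally have "a = 0" using subspace_scale_cancel[OF pencil_base_subspace] y by blast
      then show "a = 0 \<and> b = 0 \<and> c = 0" using * gh[of b c] by simp
    qed
    then show "proj_subspace 2 E" unfolding E by (rule proj_plane_span3)
    have PS: "P \<subseteq> vec.span (insert y P)" by (auto intro: vec.span_base)
    have "y \<in> vec.span (insert y P)" by (simp add: vec.span_base)
    then show "E \<subseteq> vec.span (insert y P)"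
      unfolding E using s PS by (intro vec.span_minimal vec.subspace_span) (auto intro!: vec.span_add)
    have "y + s \<in> E" unfolding E by (simp add: vec.span_base)
    moreover have "y + s \<notin> P" using vec.subspace_diff[OF pencil_base_subspace _ s(1), of "y + s"] y by auto
    ultimately show "\<not> E \<subseteq> P" by blast
  qed
  have "proj_subspace 2 E \<and> E \<subseteq> vec.span (insert y P) \<and> \<not> E \<subseteq> P"
  proof (cases "E \<in> (\<lambda>c. vec.span {y + c *s r, p, Q}) ` (UNIV - {0})")
    case True
    then obtain c where "E = vec.span {y + c *s r, p, Q}" by blast
    then show ?thesis
    proof (rule gen)
      show "a = 0 \<and> b = 0" if "a *s p + b *s Q = 0" for a b using ind'[of a b 0] that by simp
    qed (use pencil_base_mem pencil_base_subspace in \<open>auto intro: vec.subspace_scale\<close>)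
  next
    case False
    then obtain c t where "E = vec.span {y + c *s Q, p, r + t *s Q}"
      using assms by (auto simp: flag_planes_def)
    then show ?thesis
    proof (rule gen)
      show "a = 0 \<and> b = 0" if "a *s p + b *s (r + t *s Q) = 0" for a b
        using ind'[of a "b * t" b] that by (simp add: vec.scale_right_distrib vector_smult_assoc algebra_simps)
    qed (use pencil_base_mem pencil_base_subspace in \<open>auto intro!: vec.subspace_scale vec.subspace_add\<close>)
  qed
  then show "proj_subspace 2 E" "E \<subseteq> vec.span (insert y P)" "\<not> E \<subseteq> P" by auto
qed

text \<open>\<open>p\<close> and \<open>s\<close> lie on \<langle>p, Q\<rangle> or on some
  \<langle>p, r + t Q\<rangle>, and each of these lines is in a plane of the system; for the first
  one the parameter 1 is available, being nonzero. This covers the lines of \<open>P\<close> through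
  \<open>p\<close>.\<close>

lemma flag_planes_through:
  assumes "s \<in> P"
  shows "\<exists>E\<in>flag_planes y p Q r. p \<in> E \<and> s \<in> E"
proof -
  obtain a b c where s: "s = a *s p + b *s Q + c *s r" using assms unfolding P vec_span3 by blast
  show ?thesis
  proof (cases "c = 0")
    case True
    have "s \<in> vec.span {y + 1 *s r, p, Q}" by (rule in_span3I[of _ 0 _ a _ b]) (simp add: s True)
    moreover have "p \<in> vec.span {y + 1 *s r, p, Q}" by (simp add: vec.span_base)
    moreover have "vec.span {y + 1 *s r, p, Q} \<in> flag_planes y p Q r"
      unfolding flag_planes_def by (intro UnI1 image_eqI[OF refl]) simp
    ultimately show ?thesis by blast
  next
    case False
    have "s \<in> vec.span {y + 0 *s Q, p, r + (b / c) *s Q}"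
      by (rule in_span3I[of _ 0 _ a _ c]) (simp add: s False vec.scale_right_distrib vector_smult_assoc)
    moreover have "p \<in> vec.span {y + 0 *s Q, p, r + (b / c) *s Q}" by (simp add: vec.span_base)
    moreover have "vec.span {y + 0 *s Q, p, r + (b / c) *s Q} \<in> flag_planes y p Q r"
      unfolding flag_planes_def by (intro UnI2 image_eqI[of _ _ "(0, b / c)"]) auto
    ultimately show ?thesis by blast
  qed
qed

text \<open>The pair is replaced by a vector \<open>u'\<close> of the coset \<open>y + P\<close> and
  a vector \<open>v'\<close> of \<open>P\<close>. If \<open>v'\<close> has an \<open>r\<close>
  coordinate, the second family applies; if only \<open>u'\<close> has one, the first. If neither
  has one, both vectors lie in the omitted plane.\<close>

lemma flag_planes_cover_aux:
  assumes u: "u - d *s y \<in> P" and v: "v - d' *s y \<in> P" and d: "d \<noteq> 0"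
  shows "(\<exists>E\<in>flag_planes y p Q r. u \<in> E \<and> v \<in> E) \<or> (u \<in> vec.span {y, p, Q} \<and> v \<in> vec.span {y, p, Q})"
proof -
  define u' where "u' = inverse d *s u"
  define v' where "v' = v - d' *s u'"
  have lift: "u \<in> E \<and> v \<in> E" if E: "vec.subspace E" "u' \<in> E" "v' \<in> E" for E
  proof
    have "u = d *s u'" using d by (simp add: u'_def vector_smult_assoc)
    then show "u \<in> E" using E by (simp add: vec.subspace_scale)
    have "v = v' + d' *s u'" by (simp add: v'_def)
    then show "v \<in> E" using E by (simp add: vec.subspace_add vec.subspace_scale)
  qed
  have "u' - y = inverse d *s (u - d *s y)"
    using d by (simp add: u'_def vec.scale_right_diff_distrib vector_smult_assoc)
  then have u'P: "u' - y \<in> P" by (simp only: vec.subspace_scale[OF pencil_base_subspace u])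
  have "v' = (v - d' *s y) - d' *s (u' - y)" by (simp add: v'_def vec.scale_right_diff_distrib)
  then have "v' \<in> P" by (simp only: vec.subspace_diff[OF pencil_base_subspace v] vec.subspace_scale[OF pencil_base_subspace u'P])
  then obtain t1 t2 t3 where v': "v' = t1 *s p + t2 *s Q + t3 *s r" unfolding P vec_span3 by blast
  obtain s1 s2 s3 where "u' - y = s1 *s p + s2 *s Q + s3 *s r" using u'P unfolding P vec_span3 by blast
  then have u': "u' = y + s1 *s p + s2 *s Q + s3 *s r" by (simp only: diff_eq_eq add_ac)
  consider "t3 \<noteq> 0" | "t3 = 0" "s3 \<noteq> 0" | "t3 = 0" "s3 = 0" by blast
  then show ?thesis
  proof cases
    case 1
    \<comment> \<open>\<open>t\<close> puts \<open>v'\<close> on \<langle>p, r + t Q\<rangle>, and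
      \<open>c\<close> is what remains of the \<open>Q\<close> coordinate of \<open>u'\<close> once
      \<open>s3\<close> times \<open>r + t Q\<close> is taken off.\<close>
    define t where "t = t2 / t3"
    define c where "c = s2 - s3 * t"
    let ?E = "vec.span {y + c *s Q, p, r + t *s Q}"
    have s2: "s2 = c + s3 * t" by (simp add: c_def)
    have t2: "t2 = t3 * t" using 1 by (simp add: t_def)
    have "u' \<in> ?E"
      by (rule in_span3I[of _ 1 _ s1 _ s3])
         (simp only: u' s2 vec.scale_left_distrib vec.scale_right_distrib vector_smult_assoc vec.scale_one mult_1_left add_ac)
    moreover have "v' \<in> ?E"
      by (rule in_span3I[of _ 0 _ t1 _ t3])
         (simp only: v' t2 vec.scale_right_distrib vector_smult_assoc mult_zero_left vec.scale_zero_left add_0_left add_ac)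
    moreover have "?E \<in> flag_planes y p Q r"
      unfolding flag_planes_def by (intro UnI2 image_eqI[of _ _ "(c, t)"]) auto
    ultimately show ?thesis using lift vec.subspace_span by blast
  next
    case 2
    let ?E = "vec.span {y + s3 *s r, p, Q}"
    have "u' \<in> ?E" by (rule in_span3I[of _ 1 _ s1 _ s2]) (simp only: u' vec.scale_one add_ac)
    moreover have "v' \<in> ?E" by (rule in_span3I[of _ 0 _ t1 _ t2]) (simp add: v' 2)
    moreover have "?E \<in> flag_planes y p Q r"
      unfolding flag_planes_def using 2 by (intro UnI1 image_eqI[OF refl]) simp
    ultimately show ?thesis using lift vec.subspace_span by blast
  next
    case 3
    have "u' \<in> vec.span {y, p, Q}"
      by (rule in_span3I[of _ 1 _ s1 _ s2]) (simp only: u' 3 vec.scale_one vec.scale_zero_left add_0_right)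
    moreover have "v' \<in> vec.span {y, p, Q}"
      by (rule in_span3I[of _ 0 _ t1 _ t2]) (simp only: v' 3 vec.scale_zero_left add_0_right add_0_left)
    ultimately have "u \<in> vec.span {y, p, Q} \<and> v \<in> vec.span {y, p, Q}"
      by (rule lift[OF vec.subspace_span])
    then show ?thesis ..
  qed
qed

lemma flag_planes_cover:
  assumes u: "u - d *s y \<in> P" and v: "v - d' *s y \<in> P" and d: "d \<noteq> 0 \<or> d' \<noteq> 0"
  shows "(\<exists>E\<in>flag_planes y p Q r. u \<in> E \<and> v \<in> E) \<or> (u \<in> vec.span {y, p, Q} \<and> v \<in> vec.span {y, p, Q})"
  using flag_planes_cover_aux[OF u v] flag_planes_cover_aux[OF v u] d by blast

end

text \<open>\<open>cross k\<close> is linear with kernel spanned by \<open>k\<close>, so its image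
  is spanned by \<open>cross k j\<close> and \<open>cross k z\<close> when \<open>k\<close>,
  \<open>j\<close>, \<open>z\<close> is a basis. With this \<open>Q\<close> the plane omitted by
  \<open>flag_planes\<close> is the one on \<open>y\<close> and the image of
  \<open>cross k\<close>.\<close>

lemma flag_choice:
  fixes \<phi> :: "'a::{field,finite} alg_closure \<Rightarrow> 'a ^ 'n::finite"
  assumes pp: "primepow CARD('a)" and \<phi>: "ac_linear \<phi>" "\<phi> ` ext_field 3 = P"
    and \<phi>0: "\<And>x. x \<in> ext_field 3 \<Longrightarrow> \<phi> x = 0 \<Longrightarrow> x = 0"
    and k: "k \<in> ext_field 3" and j: "j \<in> ext_field 3" and kj: "cross k j \<noteq> 0"
  obtains Q r where "P = vec.span {\<phi> (cross k j), Q, r}" "indep3 (\<phi> (cross k j)) Q r"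
    "vec.span {\<phi> (cross k j), Q} = (\<lambda>l. \<phi> (cross k l)) ` ext_field 3"
proof -
  have k0: "k \<noteq> 0" and "j \<notin> range (\<lambda>a. to_ac a * k)" using kj by (auto simp: cross_scale)
  then obtain z where z: "z \<in> ext_field 3" "ac_indep3 k j z"
    using ac_indep3_extend[OF pp, of 3 k j] by auto
  have crc: "cross k (ac_comb k j z a b c) = to_ac b * cross k j + to_ac c * cross k z" for a b c
    by (simp add: ac_comb_def cross_add[OF pp] cross_scale)
  have indz: "b = 0 \<and> c = 0" if "to_ac b * cross k j + to_ac c * cross k z = 0" for b c
  proof -
    have "cross (ac_comb k j z 0 b c) k = 0"
      using that crc[of 0 b c] cross_swap[of "ac_comb k j z 0 b c" k] by simp
    then obtain a where "ac_comb k j z 0 b c = to_ac a * k" using cross_eq_0_imp k0 by blast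
    also have "\<dots> = ac_comb k j z a 0 0" by (simp add: ac_comb_def)
    finally show ?thesis using ac_indep3_eqD[OF z(2)] by blast
  qed
  have "cross k z \<notin> range (\<lambda>a. to_ac a * cross k j)"
  proof
    assume "cross k z \<in> range (\<lambda>a. to_ac a * cross k j)"
    then obtain a where "cross k z = to_ac a * cross k j" by blast
    then show False using indz[of "- a" 1] by simp
  qed
  then obtain r where r: "r \<in> ext_field 3" "ac_indep3 (cross k j) (cross k z) r"
    using ac_indep3_extend[OF pp _ kj, of 3] by auto
  have K: "cross k j \<in> ext_field 3" "cross k z \<in> ext_field 3" using cross_ext_field[OF pp k] j z by auto
  show thesis
  proof (rule that[of "\<phi> (cross k z)" "\<phi> r"])
    show "P = vec.span {\<phi> (cross k j), \<phi> (cross k z), \<phi> r}"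
    proof (intro equalityI subsetI)
      fix v assume "v \<in> P"
      then obtain s where s: "s \<in> ext_field 3" "v = \<phi> s" using \<phi>(2) by blast
      obtain a b c where "s = ac_comb (cross k j) (cross k z) r a b c"
        using ac_indep3_span[OF pp K r s(1)] by metis
      then show "v \<in> vec.span {\<phi> (cross k j), \<phi> (cross k z), \<phi> r}"
        unfolding vec_span3 using s(2) ac_linear_comb[OF \<phi>(1)] by blast
    next
      fix v assume "v \<in> vec.span {\<phi> (cross k j), \<phi> (cross k z), \<phi> r}"
      then obtain a b c where "v = \<phi> (ac_comb (cross k j) (cross k z) r a b c)"
        unfolding vec_span3 ac_linear_comb[OF \<phi>(1)] by blast
      then show "v \<in> P" using \<phi>(2) ac_comb_ext_field[OF pp K r(1)] by blast
    qed
    show "indep3 (\<phi> (cross k j)) (\<phi> (cross k z)) (\<phi> r)"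
      unfolding indep3_def
    proof (intro allI impI)
      fix a b c assume "a *s \<phi> (cross k j) + b *s \<phi> (cross k z) + c *s \<phi> r = 0"
      then have "\<phi> (ac_comb (cross k j) (cross k z) r a b c) = 0" by (simp add: ac_linear_comb[OF \<phi>(1)])
      then have "ac_comb (cross k j) (cross k z) r a b c = 0" using \<phi>0 ac_comb_ext_field[OF pp K r(1)] by blast
      then show "a = 0 \<and> b = 0 \<and> c = 0" using r(2) unfolding ac_indep3_def by blast
    qed
    show "vec.span {\<phi> (cross k j), \<phi> (cross k z)} = (\<lambda>l. \<phi> (cross k l)) ` ext_field 3"
    proof (intro equalityI subsetI)
      fix v assume "v \<in> vec.span {\<phi> (cross k j), \<phi> (cross k z)}"
      then obtain b c where "v - b *s \<phi> (cross k j) = c *s \<phi> (cross k z)"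
        by (auto simp: vec.span_breakdown_eq[of _ "\<phi> (cross k j)"] vec.span_singleton)
      then have "v = b *s \<phi> (cross k j) + c *s \<phi> (cross k z)" by (simp add: algebra_simps)
      then have "v = \<phi> (cross k (ac_comb k j z 0 b c))"
        by (simp add: crc ac_linear_add[OF \<phi>(1)] ac_linear_scale[OF \<phi>(1)])
      then show "v \<in> (\<lambda>l. \<phi> (cross k l)) ` ext_field 3" using ac_comb_ext_field[OF pp k j z(1)] by blast
    next
      fix v assume "v \<in> (\<lambda>l. \<phi> (cross k l)) ` ext_field 3"
      then obtain l where l: "l \<in> ext_field 3" "v = \<phi> (cross k l)" by blast
      obtain a b c where "l = ac_comb k j z a b c" using ac_indep3_span[OF pp k j z l(1)] by metis
      then have "v = b *s \<phi> (cross k j) + c *s \<phi> (cross k z)"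
        using l by (simp add: crc ac_linear_add[OF \<phi>(1)] ac_linear_scale[OF \<phi>(1)])
      then show "v \<in> vec.span {\<phi> (cross k j), \<phi> (cross k z)}"
        by (simp add: vec.span_add vec.span_scale vec.span_base)
    qed
  qed
qed

text \<open>
  With \<open>\<rho> = \<phi> ` K\<close> and \<open>\<psi> k + \<phi> s\<close> written as the pair \<open>(k, s)\<close>, these are the planes of the Klein
  quadric \<open>{(k, s). s \<in> cross k ` K} \<union> \<rho>\<close> that lie in the same class as \<open>\<rho>\<close> and differ from \<open>\<rho>\<close>.
\<close>

definition latin_plane :: "('a::{field,finite} alg_closure \<Rightarrow> 'a ^ 'n) \<Rightarrow> ('a alg_closure \<Rightarrow> 'a ^ 'n) \<Rightarrow>
    'a alg_closure \<Rightarrow> 'a alg_closure \<Rightarrow> 'a alg_closure \<Rightarrow> ('a ^ 'n) set" where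
  "latin_plane \<psi> \<phi> k l b = vec.span {\<psi> k + \<phi> (cross b k), \<psi> l + \<phi> (cross b l), \<phi> (cross k l)}"

text \<open>Only the class of \<open>b\<close> modulo \<langle>g, h\<rangle> matters: changing
  \<open>b\<close> by an element of this line changes \<open>cross b k\<close>, for \<open>k\<close>
  on the line, by a multiple of \<open>cross g h\<close>, and \<open>\<phi> (cross g h)\<close> lies
  in the plane.\<close>

lemma latin_plane_contains:
  fixes \<psi> \<phi> :: "'a::{field,finite} alg_closure \<Rightarrow> 'a ^ 'n"
  assumes pp: "primepow CARD('a)" and \<psi>: "ac_linear \<psi>" and \<phi>: "ac_linear \<phi>"
    and k: "k = to_ac c * g + to_ac d * h"
    and b: "b = to_ac e * g + to_ac f * h + b'"
  shows "\<psi> k + \<phi> (cross b k) \<in> latin_plane \<psi> \<phi> g h b'"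
  unfolding latin_plane_def
proof (rule in_span3I[of _ c _ d _ "e * d - f * c"])
  have "cross b k = to_ac c * cross b' g + to_ac d * cross b' h + to_ac (e * d - f * c) * cross g h"
    unfolding k b
    by (simp only: cross_add[OF pp] cross_scale cross_self cross_swap[of h g] to_ac_diff to_ac_mult)
      (simp only: ring_distribs mult_ac mult_zero_right mult_zero_left mult_minus_right mult_minus_left
        add_0_left add_0_right diff_conv_add_uminus add_ac)
  then have 1: "\<phi> (cross b k) = c *s \<phi> (cross b' g) + d *s \<phi> (cross b' h) + (e * d - f * c) *s \<phi> (cross g h)"
    by (simp only: ac_linear_add[OF \<phi>] ac_linear_scale[OF \<phi>])
  have 2: "\<psi> k = c *s \<psi> g + d *s \<psi> h"
    by (simp only: k ac_linear_add[OF \<psi>] ac_linear_scale[OF \<psi>])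
  show "\<psi> k + \<phi> (cross b k) = c *s (\<psi> g + \<phi> (cross b' g)) + d *s (\<psi> h + \<phi> (cross b' h))
      + (e * d - f * c) *s \<phi> (cross g h)"
    by (simp only: 1 2 vec.scale_right_distrib add_ac)
qed

lemma latin_plane_contains_cross:
  fixes \<phi> :: "'a::{field,finite} alg_closure \<Rightarrow> 'a ^ 'n"
  assumes pp: "primepow CARD('a)" and \<phi>: "ac_linear \<phi>"
    and k: "k = to_ac c * g + to_ac d * h" and l: "l = to_ac c' * g + to_ac d' * h"
  shows "\<phi> (cross k l) \<in> latin_plane \<psi> \<phi> g h b"
proof -
  have "cross k l = to_ac (c * d' - d * c') * cross g h"
    unfolding k l
    by (simp only: cross_add[OF pp] cross_scale cross_self cross_swap[of h g] to_ac_diff to_ac_mult)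
      (simp only: ring_distribs mult_ac mult_zero_right mult_zero_left mult_minus_right mult_minus_left
        add_0_left add_0_right diff_conv_add_uminus add_ac)
  then have "\<phi> (cross k l) = (c * d' - d * c') *s \<phi> (cross g h)" by (simp only: ac_linear_scale[OF \<phi>])
  moreover have "\<phi> (cross g h) \<in> latin_plane \<psi> \<phi> g h b" by (simp add: latin_plane_def vec.span_base)
  ultimately show ?thesis unfolding latin_plane_def by (simp only: vec.span_scale)
qed

section \<open>Normalised points and lines of the projective plane on GF(q^3)\<close>

lemma ac_comb_scale: "to_ac e * ac_comb x y z a b c = ac_comb x y z (e * a) (e * b) (e * c)"
  by (simp only: ac_comb_def to_ac_mult ring_distribs mult.assoc)

lemma ac_comb_add: "ac_comb x y z a b c + ac_comb x y z a' b' c' = ac_comb x y z (a + a') (b + b') (c + c')"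
  by (simp add: ac_comb_def ring_distribs)

text \<open>A vanishing \<open>cross\<close> makes \<open>k\<close> and \<open>l\<close>
  proportional. The common point is normalised by its \<open>z\<close> coordinate first, then by
  \<open>x\<close>, then by \<open>y\<close>, so that a zero \<open>z\<close> coordinate singles out
  the line at infinity.\<close>

lemma ac_proportional_common_point:
  fixes k l x y z :: "'a::{field,finite} alg_closure"
  assumes pp: "primepow CARD('a)" and K: "x \<in> ext_field 3" "y \<in> ext_field 3" "z \<in> ext_field 3"
    and ind: "ac_indep3 x y z" and kl: "k \<in> ext_field 3" "l \<in> ext_field 3" and cr: "cross k l = 0"
  obtains g d d' where "(\<exists>a b. g = ac_comb x y z a b 1) \<or> (\<exists>a. g = ac_comb x y z 1 a 0) \<or> g = ac_comb x y z 0 1 0"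
    "k = to_ac d * g" "l = to_ac d' * g"
proof -
  let ?pt = "\<lambda>g. (\<exists>a b. g = ac_comb x y z a b 1) \<or> (\<exists>a. g = ac_comb x y z 1 a 0) \<or> g = ac_comb x y z 0 1 0"
  have norm: "\<exists>g d. ?pt g \<and> m = to_ac d * g" if m: "m \<in> ext_field 3" for m
  proof -
    obtain a b c where abc: "m = ac_comb x y z a b c" using ac_indep3_span[OF pp K ind m] by metis
    consider "c \<noteq> 0" | "c = 0" "a \<noteq> 0" | "c = 0" "a = 0" by blast
    then show ?thesis
    proof cases
      case 1
      then have "m = to_ac c * ac_comb x y z (a / c) (b / c) 1" by (simp add: abc ac_comb_scale)
      then show ?thesis by blast
    next
      case 2
      then have "m = to_ac a * ac_comb x y z 1 (b / a) 0" by (simp add: abc ac_comb_scale)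
      then show ?thesis by blast
    next
      case 3
      then have "m = to_ac b * ac_comb x y z 0 1 0" by (simp add: abc ac_comb_scale)
      then show ?thesis by blast
    qed
  qed
  show thesis
  proof (cases "l = 0")
    case True
    obtain g d where "?pt g" "k = to_ac d * g" using norm[OF kl(1)] by blast
    then show thesis using True by (intro that[of g d 0]) simp_all
  next
    case False
    obtain e where e: "k = to_ac e * l" using cross_eq_0_imp[OF cr False] by blast
    obtain g d where g: "?pt g" "l = to_ac d * g" using norm[OF kl(2)] by blast
    then have "k = to_ac (e * d) * g" using e by simp
    then show thesis using g by (intro that[of g "e * d" d])
  qed
qed

text \<open>One basis \<open>g\<close>, \<open>h\<close> for each of the q^2 + q + 1 lines of the
  projective plane on \<open>x\<close>, \<open>y\<close>, \<open>z\<close>, with a third vector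
  \<open>e\<close> completing it. In order: the line at infinity \<langle>x, y\<rangle>, the q^2
  lines meeting it in a point x + a y, and the q other lines through \<open>y\<close>. Except in the
  first case \<open>g\<close> is an affine point. The multiples of \<open>e\<close> represent the
  classes modulo the line.\<close>

definition line_frame :: "'a::{field,finite} alg_closure \<Rightarrow> 'a alg_closure \<Rightarrow> 'a alg_closure \<Rightarrow>
    'a alg_closure \<Rightarrow> 'a alg_closure \<Rightarrow> 'a alg_closure \<Rightarrow> bool" where
  "line_frame x y z g h e \<longleftrightarrow> g = x \<and> h = y \<and> e = z \<or>
     (\<exists>a c. g = z + to_ac c * y \<and> h = x + to_ac a * y \<and> e = y) \<or> (\<exists>c. g = z + to_ac c * x \<and> h = y \<and> e = x)"

lemma line_frame_span:
  fixes x y z :: "'a::{field,finite} alg_closure"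
  assumes "line_frame x y z g h e"
  obtains a' b' c' where "ac_comb x y z a b c = to_ac a' * g + to_ac b' * h + to_ac c' * e"
proof -
  consider "g = x" "h = y" "e = z" | t s where "g = z + to_ac s * y" "h = x + to_ac t * y" "e = y"
    | s where "g = z + to_ac s * x" "h = y" "e = x" using assms unfolding line_frame_def by blast
  then show thesis
  proof cases
    case 1
    then show thesis by (intro that[of a b c]) (simp add: ac_comb_def)
  next
    case 2
    then show thesis by (intro that[of c a "b - a * t - c * s"]) (simp add: ac_comb_def ring_distribs)
  next
    case 3
    then show thesis by (intro that[of c b "a - c * s"]) (simp add: ac_comb_def ring_distribs)
  qed
qed

text \<open>As \<open>k\<close> is affine, subtracting a multiple of it from \<open>l\<close> gives
  the intersection of the line with the line at infinity. That point is normalised to x + t y if its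
  \<open>x\<close> coordinate is nonzero and to \<open>y\<close> otherwise; \<open>s\<close> is then
  read off from \<open>k\<close>.\<close>

lemma line_frame_exists_aux:
  fixes x y z :: "'a::{field,finite} alg_closure"
  assumes ind: "ac_indep3 x y z" and k: "k = ac_comb x y z a b c" and l: "l = ac_comb x y z a' b' c'"
    and kl: "cross k l \<noteq> 0" and c: "c \<noteq> 0"
  obtains g h e p q p' q' where "line_frame x y z g h e"
    "k = to_ac p * g + to_ac q * h" "l = to_ac p' * g + to_ac q' * h"
proof -
  define \<alpha> \<beta> where "\<alpha> = a' - c' / c * a" and "\<beta> = b' - c' / c * b"
  have l': "l = to_ac (c' / c) * k + ac_comb x y z \<alpha> \<beta> 0"
    unfolding k l ac_comb_scale ac_comb_add using c by (simp add: \<alpha>_def \<beta>_def)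
  have "\<alpha> \<noteq> 0 \<or> \<beta> \<noteq> 0"
  proof (rule ccontr)
    assume "\<not> (\<alpha> \<noteq> 0 \<or> \<beta> \<noteq> 0)"
    then have "l = to_ac (c' / c) * k" using l' by (simp add: ac_comb_def)
    then have "cross k l = to_ac (c' / c) * cross k k" by (simp only: cross_scale)
    then show False using kl by simp
  qed
  then consider "\<alpha> \<noteq> 0" | "\<alpha> = 0" "\<beta> \<noteq> 0" by blast
  then show thesis
  proof cases
    case 1
    define t where "t = \<beta> / \<alpha>"
    define s where "s = (b - a * t) / c"
    have frame: "line_frame x y z (ac_comb x y z 0 s 1) (ac_comb x y z 1 t 0) y"
      unfolding line_frame_def ac_comb_def by (intro disjI2 disjI1 exI[of _ t] exI[of _ s]) (simp add: add.commute)
    have "c * s + a * t = b" using c by (simp add: s_def)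
    then have k': "k = to_ac c * ac_comb x y z 0 s 1 + to_ac a * ac_comb x y z 1 t 0"
      by (simp add: k ac_comb_scale ac_comb_add)
    have "\<beta> = \<alpha> * t" using 1 by (simp add: t_def)
    then have "ac_comb x y z \<alpha> \<beta> 0 = to_ac \<alpha> * ac_comb x y z 1 t 0"
      by (simp add: ac_comb_scale)
    then have "l = to_ac (c' / c * c) * ac_comb x y z 0 s 1 + to_ac (c' / c * a + \<alpha>) * ac_comb x y z 1 t 0"
      unfolding l' k' by (simp only: to_ac_mult to_ac_add ring_distribs mult.assoc add.assoc)
    with frame k' show thesis by (rule that)
  next
    case 2
    define s where "s = a / c"
    have frame: "line_frame x y z (ac_comb x y z s 0 1) (ac_comb x y z 0 1 0) x"
      unfolding line_frame_def ac_comb_def by (intro disjI2 exI[of _ s]) (simp add: add.commute)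
    have "c * s = a" using c by (simp add: s_def)
    then have k': "k = to_ac c * ac_comb x y z s 0 1 + to_ac b * ac_comb x y z 0 1 0"
      by (simp add: k ac_comb_scale ac_comb_add)
    have "ac_comb x y z \<alpha> \<beta> 0 = to_ac \<beta> * ac_comb x y z 0 1 0"
      using 2(1) by (simp add: ac_comb_scale)
    then have "l = to_ac (c' / c * c) * ac_comb x y z s 0 1 + to_ac (c' / c * b + \<beta>) * ac_comb x y z 0 1 0"
      unfolding l' k' by (simp only: to_ac_mult to_ac_add ring_distribs mult.assoc add.assoc)
    with frame k' show thesis by (rule that)
  qed
qed

lemma line_frame_exists:
  fixes x y z :: "'a::{field,finite} alg_closure"
  assumes ind: "ac_indep3 x y z" and k: "k = ac_comb x y z a b c" and l: "l = ac_comb x y z a' b' c'"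
    and kl: "cross k l \<noteq> 0"
  obtains g h e p q p' q' where "line_frame x y z g h e"
    "k = to_ac p * g + to_ac q * h" "l = to_ac p' * g + to_ac q' * h"
proof -
  consider "c = 0" "c' = 0" | "c \<noteq> 0" | "c' \<noteq> 0" by blast
  then show thesis
  proof cases
    case 1
    have "line_frame x y z x y z" by (simp add: line_frame_def)
    moreover have "k = to_ac a * x + to_ac b * y" "l = to_ac a' * x + to_ac b' * y"
      by (simp_all add: k l 1 ac_comb_def)
    ultimately show thesis by (rule that)
  next
    case 2
    show thesis using line_frame_exists_aux[OF ind k l kl 2] that by metis
  next
    case 3
    have "cross l k \<noteq> 0" using kl cross_swap[of l k] by simp
    then show thesis using line_frame_exists_aux[OF ind l k _ 3] that by metis
  qed
qed

lemma aff_count_3: "aff_count q 3 = q ^ 3 + (q ^ 4 + q ^ 6)"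
  by (simp add: aff_count_def numeral_2_eq_2 eval_nat_numeral)

lemma inf_count_3: "inf_count q 3 = (q + 1) * (q + q ^ 2) - 1"
  by (simp add: inf_count_def aff_count_def eval_nat_numeral)

lemma ac_indep3_cross:
  assumes ind: "ac_indep3 x y z" and cr: "cross (ac_comb x y z a b c) (ac_comb x y z a' b' c') = 0"
    and nz: "\<not> (a' = 0 \<and> b' = 0 \<and> c' = 0)"
  obtains e where "a = e * a'" "b = e * b'" "c = e * c'"
proof -
  have "ac_comb x y z a' b' c' \<noteq> 0" using ind nz unfolding ac_indep3_def by blast
  then obtain e where "ac_comb x y z a b c = to_ac e * ac_comb x y z a' b' c'"
    using cross_eq_0_imp[OF cr] by blast
  then have "ac_comb x y z a b c = ac_comb x y z (e * a') (e * b') (e * c')" by (simp only: ac_comb_scale)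
  then show thesis using ac_indep3_eqD[OF ind] that by blast
qed

lemma line_frame_cases:
  assumes "line_frame x y z g h e"
  obtains "g = ac_comb x y z 1 0 0" "h = ac_comb x y z 0 1 0" "e = ac_comb x y z 0 0 1"
  | a c where "g = ac_comb x y z 0 c 1" "h = ac_comb x y z 1 a 0" "e = ac_comb x y z 0 1 0"
  | c where "g = ac_comb x y z c 0 1" "h = ac_comb x y z 0 1 0" "e = ac_comb x y z 1 0 0"
proof -
  consider "g = x" "h = y" "e = z" | a c where "g = z + to_ac c * y" "h = x + to_ac a * y" "e = y"
    | c where "g = z + to_ac c * x" "h = y" "e = x" using assms unfolding line_frame_def by blast
  then show thesis
  proof cases
    case 1
    then show thesis by (intro that(1)) (simp_all add: ac_comb_def)
  next
    case (2 a c)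
    then show thesis by (intro that(2)[of c a]) (simp_all add: ac_comb_def add.commute)
  next
    case (3 c)
    then show thesis by (intro that(3)[of c]) (simp_all add: ac_comb_def add.commute)
  qed
qed

lemma line_frame_cross:
  assumes ind: "ac_indep3 x y z" and fr: "line_frame x y z g h e"
  shows "cross g h \<noteq> 0"
proof
  assume cr: "cross g h = 0"
  show False using fr
  proof (cases rule: line_frame_cases)
    case 1
    then show False using ac_indep3_cross[OF ind, of 1 0 0 0 1 0] cr by fastforce
  next
    case (2 a c)
    then show False using ac_indep3_cross[OF ind, of 0 c 1 1 a 0] cr by fastforce
  next
    case (3 c)
    then show False using ac_indep3_cross[OF ind, of c 0 1 0 1 0] cr by fastforce
  qed
qed

lemma cross_nonzero_indep:
  assumes pp: "primepow CARD('a::{field,finite})" and gh: "cross g h \<noteq> (0 :: 'a alg_closure)"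
    and 0: "to_ac a * g + to_ac b * h = 0"
  shows "a = 0 \<and> b = 0"
proof -
  have "cross (to_ac a * g + to_ac b * h) h = to_ac a * cross g h"
    by (simp only: cross_add[OF pp] cross_scale cross_self mult_zero_right add_0_right)
  then have "to_ac a * cross g h = 0" unfolding 0 by simp
  moreover have "cross g (to_ac a * g + to_ac b * h) = to_ac b * cross g h"
    by (simp only: cross_add[OF pp] cross_scale cross_self mult_zero_right add_0_left)
  then have "to_ac b * cross g h = 0" unfolding 0 by simp
  ultimately show ?thesis using gh by simp
qed

text \<open>Read modulo \<open>P\<close>, a relation between the generators becomes one between
  \<open>g\<close> and \<open>h\<close>, since \<psi> is injective modulo \<open>P\<close>. The last
  coefficient vanishes because \<phi> is injective and \<open>cross g h\<close> is nonzero.\<close>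

lemma latin_plane_plane:
  fixes \<psi> \<phi> :: "'a::{field,finite} alg_closure \<Rightarrow> 'a ^ 'n::finite"
  assumes pp: "primepow CARD('a)" and \<psi>: "ac_linear \<psi>" and \<phi>: "ac_linear \<phi>" "\<phi> ` ext_field N = P"
    and P: "vec.subspace P" and \<phi>0: "\<And>s. s \<in> ext_field N \<Longrightarrow> \<phi> s = 0 \<Longrightarrow> s = 0"
    and \<psi>P: "\<And>k. k \<in> ext_field N \<Longrightarrow> \<psi> k \<in> P \<Longrightarrow> k = 0"
    and K: "g \<in> ext_field N" "h \<in> ext_field N" "b \<in> ext_field N" and gh: "cross g h \<noteq> 0"
  shows "proj_subspace 2 (latin_plane \<psi> \<phi> g h b)"
  unfolding latin_plane_def
proof (rule proj_plane_span3, unfold indep3_def, intro allI impI)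
  fix u v w
  assume *: "u *s (\<psi> g + \<phi> (cross b g)) + v *s (\<psi> h + \<phi> (cross b h)) + w *s \<phi> (cross g h) = 0"
  have K': "\<phi> (cross b g) \<in> P" "\<phi> (cross b h) \<in> P" "\<phi> (cross g h) \<in> P"
    using cross_ext_field[OF pp] K \<phi>(2) by blast+
  have "\<psi> (to_ac u * g + to_ac v * h) = u *s \<psi> g + v *s \<psi> h"
    by (simp only: ac_linear_add[OF \<psi>] ac_linear_scale[OF \<psi>])
  also have "\<dots> = - (u *s \<phi> (cross b g) + v *s \<phi> (cross b h) + w *s \<phi> (cross g h))"
    by (rule eq_neg_iff_add_eq_0[THEN iffD2]) (use * in \<open>simp only: vec.scale_right_distrib add_ac\<close>)
  also have "\<dots> \<in> P" using K' P by (intro vec.subspace_neg vec.subspace_add vec.subspace_scale)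
  finally have "to_ac u * g + to_ac v * h = 0"
    using K by (intro \<psi>P ext_field_add pp ext_field_mult ext_field_to_ac)
  then have uv: "u = 0 \<and> v = 0" by (rule cross_nonzero_indep[OF pp gh])
  then have "\<phi> (to_ac w * cross g h) = 0" using * by (simp add: ac_linear_scale[OF \<phi>(1)])
  then have "to_ac w * cross g h = 0"
    using \<phi>0 K by (meson cross_ext_field pp ext_field_mult ext_field_to_ac)
  then show "u = 0 \<and> v = 0 \<and> w = 0" using uv gh by simp
qed

lemma latin_plane_subset:
  assumes "vec.subspace U" "\<psi> g \<in> U" "\<psi> h \<in> U" "\<phi> (cross b g) \<in> U" "\<phi> (cross b h) \<in> U" "\<phi> (cross g h) \<in> U"
  shows "latin_plane \<psi> \<phi> g h b \<subseteq> U"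
  unfolding latin_plane_def using assms by (intro vec.span_minimal) (auto intro: vec.subspace_add)

text \<open>The line on \<open>k\<close> and \<open>l\<close> selects the frame, and the class of
  \<open>b\<close> modulo that line selects \<open>t\<close>.\<close>

lemma latin_plane_cover:
  fixes \<psi> \<phi> :: "'a::{field,finite} alg_closure \<Rightarrow> 'a ^ 'n::finite"
  assumes pp: "primepow CARD('a)" and \<psi>: "ac_linear \<psi>" and \<phi>: "ac_linear \<phi>"
    and K: "x \<in> ext_field 3" "y \<in> ext_field 3" "z \<in> ext_field 3" and ind: "ac_indep3 x y z"
    and kl: "k \<in> ext_field 3" "l \<in> ext_field 3" "b \<in> ext_field 3" "cross k l \<noteq> 0"
  obtains g h e t where "line_frame x y z g h e" "\<psi> k + \<phi> (cross b k) \<in> latin_plane \<psi> \<phi> g h (to_ac t * e)"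
    "\<psi> l + \<phi> (cross b l) \<in> latin_plane \<psi> \<phi> g h (to_ac t * e)"
    "\<phi> (cross k l) \<in> latin_plane \<psi> \<phi> g h (to_ac t * e)"
proof -
  obtain k1 k2 k3 where k: "k = ac_comb x y z k1 k2 k3" using ac_indep3_span[OF pp K ind kl(1)] by metis
  obtain l1 l2 l3 where l: "l = ac_comb x y z l1 l2 l3" using ac_indep3_span[OF pp K ind kl(2)] by metis
  obtain b1 b2 b3 where b: "b = ac_comb x y z b1 b2 b3" using ac_indep3_span[OF pp K ind kl(3)] by metis
  obtain g h e p q p' q' where fr: "line_frame x y z g h e"
    and k': "k = to_ac p * g + to_ac q * h" and l': "l = to_ac p' * g + to_ac q' * h"
    using line_frame_exists[OF ind k l kl(4)] by metis
  obtain c1 c2 c3 where b': "b = to_ac c1 * g + to_ac c2 * h + to_ac c3 * e"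
    using line_frame_span[OF fr] b by metis
  show thesis
    using that[OF fr] latin_plane_contains[OF pp \<psi> \<phi> k' b'] latin_plane_contains[OF pp \<psi> \<phi> l' b']
      latin_plane_contains_cross[OF pp \<phi> k' l'] by blast
qed

text \<open>Two lines of the projective plane \<open>P\<close> always meet. The combination may be
  zero when \<open>u\<close> and \<open>v\<close> are dependent.\<close>

lemma pencil_meets_line:
  fixes \<phi> :: "'a::{field,finite} alg_closure \<Rightarrow> 'a ^ 'n::finite"
  assumes pp: "primepow CARD('a)" and \<phi>: "ac_linear \<phi>" "\<phi> ` ext_field 3 = P"
    and \<phi>0: "\<And>s. s \<in> ext_field 3 \<Longrightarrow> \<phi> s = 0 \<Longrightarrow> s = 0"
    and k: "k \<in> ext_field 3" and j: "j \<in> ext_field 3" and kj: "cross k j \<noteq> 0"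
    and uv: "u \<in> P" "v \<in> P"
  obtains a b m where "a \<noteq> 0 \<or> b \<noteq> 0" "m \<in> ext_field 3" "a *s u + b *s v = \<phi> (cross k m)"
proof -
  obtain Q r where Qr: "P = vec.span {\<phi> (cross k j), Q, r}"
    "vec.span {\<phi> (cross k j), Q} = (\<lambda>l. \<phi> (cross k l)) ` ext_field 3"
    using flag_choice[OF pp \<phi> \<phi>0 k j kj] by metis
  let ?p = "\<phi> (cross k j)"
  obtain u1 u2 u3 where u: "u = u1 *s ?p + u2 *s Q + u3 *s r" using uv(1) unfolding Qr(1) vec_span3 by blast
  obtain v1 v2 v3 where v: "v = v1 *s ?p + v2 *s Q + v3 *s r" using uv(2) unfolding Qr(1) vec_span3 by blast
  \<comment> \<open>The combination is \<open>u\<close> itself if \<open>u\<close> has no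
    \<open>r\<close> coordinate and \<open>v3 u - u3 v\<close> otherwise, so the \<open>r\<close>
    coordinate cancels.\<close>
  define a b where "a = (if u3 = 0 then 1 else v3)" and "b = (if u3 = 0 then 0 else - u3)"
  have "a * u3 + b * v3 = 0" by (simp add: a_def b_def)
  then have "a *s u + b *s v = (a * u1 + b * v1) *s ?p + (a * u2 + b * v2) *s Q"
    unfolding u v by (vector algebra_simps) (metis (no_types) distrib_right mult_zero_left add.commute mult.assoc)
  then have "a *s u + b *s v \<in> vec.span {?p, Q}"
    by (simp only: vec.span_add vec.span_scale vec.span_base insertI1 insertI2)
  then obtain m where "m \<in> ext_field 3" "a *s u + b *s v = \<phi> (cross k m)" using Qr(2) by blast
  moreover have "a \<noteq> 0 \<or> b \<noteq> 0" by (simp add: a_def b_def)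
  ultimately show thesis using that by blast
qed

lemma coverable_base:
  fixes H :: "('a::{field,finite} ^ 'n::finite) set"
  assumes pp: "primepow CARD('a)" and H: "vec.subspace H" "vec.dim H = 5"
  shows "coverable 3 H"
\<comment> \<open>Without a vector outside \<open>H\<close> nothing has to be covered and the empty
  set will do. Otherwise a fixed \<open>x0\<close> serves to write down the planes inside
  \<open>H\<close>.\<close>
proof (cases "H = UNIV")
  case True
  then show ?thesis unfolding coverable_def by (intro exI[of _ "{}"]) auto
next
  case False
  then obtain x0 where x0: "x0 \<notin> H" by blast
  let ?q = "CARD('a)"
  let ?K = "ext_field 3 :: 'a alg_closure set"
  have q1: "?q > 1" by (rule CARD_field_gt_1)
  have "vec.dim H = 3 + 2" using H(2) by simp
  then obtain P w1 w2 where P: "vec.subspace P" "vec.dim P = 3" "P \<subseteq> H" and w: "w1 \<in> H" "w2 \<in> H"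
    and split: "\<And>v. v \<in> H \<Longrightarrow> \<exists>a b. v - a *s w1 - b *s w2 \<in> P"
    and im: "\<And>x. x \<notin> H \<Longrightarrow> indep_mod P w1 w2 x"
    using subspace_split2[OF H(1)] by metis
  obtain \<phi> :: "'a alg_closure \<Rightarrow> 'a ^ 'n" where \<phi>: "ac_linear \<phi>" "\<phi> ` ?K = P"
    and \<phi>0: "\<And>s. s \<in> ?K \<Longrightarrow> \<phi> s = 0 \<Longrightarrow> s = 0"
    using ext_field_parametrisation[OF pp P(1,2)] by (metis zero_less_numeral)
  obtain x1 x2 x3 :: "'a alg_closure" where K: "x1 \<in> ?K" "x2 \<in> ?K" "x3 \<in> ?K"
    and ind: "ac_indep3 x1 x2 x3" using ac_indep3_exists[OF pp order_refl] by metis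
  define cb where "cb = ac_comb x1 x2 x3"
  have cbK: "cb a b c \<in> ?K" for a b c unfolding cb_def by (rule ac_comb_ext_field[OF pp K])
  have K_cb: "\<exists>a b c. k = cb a b c" if "k \<in> ?K" for k
    unfolding cb_def using ac_indep3_span[OF pp K ind that] by metis
  have cb0: "cb a b c = 0 \<Longrightarrow> a = 0 \<and> b = 0 \<and> c = 0" for a b c
    using ind unfolding ac_indep3_def cb_def by blast
  have cb_x: "cb 1 0 0 = x1" "cb 0 1 0 = x2" "cb 0 0 1 = x3" by (simp_all add: cb_def ac_comb_def)

  \<comment> \<open>\<open>\<Psi> x\<close> identifies GF(q^3) with the complement of
    \<open>P\<close> spanned by \<open>w1\<close>, \<open>w2\<close>, \<open>x\<close>, so that
    \<open>\<Psi> x k + \<phi> s\<close> is the pair (k, s). Only the image of \<open>x3\<close>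
    depends on \<open>x\<close>.\<close>
  have "\<forall>x. \<exists>f. ac_linear f \<and> f x1 = w1 \<and> f x2 = w2 \<and> f x3 = x"
    using ac_linear_exists3[OF ind] by metis
  then obtain \<Psi> where \<Psi>: "\<And>x. ac_linear (\<Psi> x)"
    and \<Psi>x: "\<And>x. \<Psi> x x1 = w1" "\<And>x. \<Psi> x x2 = w2" "\<And>x. \<Psi> x x3 = x" by metis
  have \<Psi>cb: "\<Psi> x (cb a b c) = a *s w1 + b *s w2 + c *s x" for x a b c
    unfolding cb_def ac_linear_comb[OF \<Psi>] \<Psi>x ..
  have \<Psi>P: "k = 0" if "x \<notin> H" "k \<in> ?K" "\<Psi> x k \<in> P" for x k
  proof -
    obtain a b c where k: "k = cb a b c" using K_cb[OF \<open>k \<in> ?K\<close>] by blast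
    then have "a = 0 \<and> b = 0 \<and> c = 0" using im[OF that(1)] that(3) \<Psi>cb unfolding indep_mod_def by metis
    then show ?thesis by (simp add: k cb_def ac_comb_def)
  qed
  have \<phi>P: "\<phi> s \<in> P" if "s \<in> ?K" for s using \<phi>(2) that by blast

  \<comment> \<open>Using \<open>x1\<close> whenever possible puts the points \<open>p k\<close>,
    for \<open>k\<close> not proportional to \<open>x1\<close>, on one line, the image under \<phi>
    of the multiples \<open>cross x1 m\<close>. Lines inside \<open>P\<close> will be covered
    because they meet this line.\<close>
  define j where "j k = (if cross k x1 = 0 then x2 else x1)" for k
  have jK: "j k \<in> ?K" for k using K by (simp add: j_def)
  have jk: "cross k (j k) \<noteq> 0" if k: "k \<in> ?K" "k \<noteq> 0" for k
  proof (cases "cross k x1 = 0")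
    case True
    have "x1 \<noteq> 0" using cb0[of 1 0 0] cb_x by auto
    then obtain c where c: "k = to_ac c * x1" using cross_eq_0_imp[OF True] by blast
    have "cross x1 x2 \<noteq> 0"
      using line_frame_cross[OF ind, of x1 x2 x3] by (simp add: line_frame_def)
    then show ?thesis using True k(2) c by (simp add: j_def cross_scale)
  qed (simp add: j_def)
  define p where "p k = \<phi> (cross k (j k))" for k
  have "\<forall>k. \<exists>Q r. k \<in> ?K \<longrightarrow> k \<noteq> 0 \<longrightarrow> P = vec.span {p k, Q, r} \<and> indep3 (p k) Q r \<and>
      vec.span {p k, Q} = (\<lambda>l. \<phi> (cross k l)) ` ?K"
    unfolding p_def using flag_choice[OF pp \<phi> \<phi>0 _ jK jk] by metis
  then obtain Q r where Qr: "\<And>k. k \<in> ?K \<Longrightarrow> k \<noteq> 0 \<Longrightarrow> P = vec.span {p k, Q k, r k}"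
    "\<And>k. k \<in> ?K \<Longrightarrow> k \<noteq> 0 \<Longrightarrow> indep3 (p k) (Q k) (r k)"
    "\<And>k. k \<in> ?K \<Longrightarrow> k \<noteq> 0 \<Longrightarrow> vec.span {p k, Q k} = (\<lambda>l. \<phi> (cross k l)) ` ?K"
    by metis

  define aff where "aff = (\<lambda>(a, b). cb a b 1) ` UNIV"
  define inf where "inf = insert (cb 0 1 0) ((\<lambda>a. cb 1 a 0) ` UNIV)"
  have pts: "k \<in> ?K" "k \<noteq> 0" if "k \<in> aff \<union> inf" for k
  proof -
    have "\<exists>a b c. k = cb a b c \<and> \<not> (a = 0 \<and> b = 0 \<and> c = 0)"
      using that unfolding aff_def inf_def by (auto, metis zero_neq_one, metis zero_neq_one, metis zero_neq_one)
    then obtain a b c where k: "k = cb a b c" and nz: "\<not> (a = 0 \<and> b = 0 \<and> c = 0)" by blast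
    show "k \<in> ?K" unfolding k by (rule cbK)
    show "k \<noteq> 0" unfolding k using cb0[of a b c] nz by blast
  qed
  have card_aff: "card aff \<le> ?q ^ 2"
    using card_image_le[of "UNIV :: ('a \<times> 'a) set" "\<lambda>(a, b). cb a b 1"] by (simp add: aff_def power2_eq_square)
  have card_inf: "card inf \<le> ?q + 1"
  proof -
    have "card ((\<lambda>a. cb 1 a 0) ` UNIV) \<le> ?q" by (rule card_image_le) simp
    then show ?thesis unfolding inf_def by (simp add: card_insert_if le_SucI)
  qed
  have \<Psi>aff: "\<Psi> x k \<in> aff_points w1 w2 x" if k: "k \<in> aff" for x k
  proof -
    obtain a b where "k = cb a b 1" using k by (auto simp: aff_def)
    then have "\<Psi> x k = a *s w1 + b *s w2 + x" by (simp add: \<Psi>cb)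
    then show ?thesis unfolding aff_points_def by (intro image_eqI[of _ _ "(a, b)"]) auto
  qed
  \<comment> \<open>Points at infinity have no \<open>x3\<close> coordinate; this is why the planes
    inside \<open>H\<close> can be built from \<open>x0\<close> alone.\<close>
  have \<Psi>inf: "\<Psi> x k \<in> H" "\<Psi> x k = \<Psi> x0 k" if k: "k \<in> inf" for x k
  proof -
    consider "k = cb 0 1 0" | a where "k = cb 1 a 0" using k unfolding inf_def by blast
    then have "\<Psi> x k \<in> H \<and> \<Psi> x k = \<Psi> x0 k"
    proof cases
      case 1
      then show ?thesis using w by (simp add: \<Psi>cb)
    next
      case (2 a)
      then have "\<Psi> y k = w1 + a *s w2" for y by (simp add: \<Psi>cb)
      then show ?thesis using vec.subspace_add[OF H(1) w(1) vec.subspace_scale[OF H(1) w(2)]] by simp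
    qed
    then show "\<Psi> x k \<in> H" "\<Psi> x k = \<Psi> x0 k" by blast+
  qed

  \<comment> \<open>\<open>Fl\<close> gives the planes in the solid over a point, \<open>TB\<close>
    and \<open>TA\<close> the planes of the Klein quadric over the line at infinity and over the
    affine lines, \<open>GR\<close> the graphs that are kept.\<close>
  define Fl where "Fl x k = flag_planes (\<Psi> x k) (p k) (Q k) (r k)" for x k
  define TB where "TB = (\<lambda>t. latin_plane (\<Psi> x0) \<phi> (cb 1 0 0) (cb 0 1 0) (to_ac t * cb 0 0 1)) ` UNIV"
  define TA where "TA x = (\<lambda>(a, c, t). latin_plane (\<Psi> x) \<phi> (cb 0 c 1) (cb 1 a 0) (to_ac t * cb 0 1 0)) ` UNIV \<union>
      (\<lambda>(c, t). latin_plane (\<Psi> x) \<phi> (cb c 0 1) (cb 0 1 0) (to_ac t * cb 1 0 0)) ` UNIV" for x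
  \<comment> \<open>The pairs with \<open>\<alpha> = - frob \<beta>\<close> are left out: for them
    the linearised polynomial is \<open>cross \<beta>\<close>, and the latin planes take
    over.\<close>
  define GR where "GR x = (\<lambda>(\<alpha>, \<beta>). graph_plane \<phi> w1 w2 x x1 x2 x3 \<alpha> \<beta>) ` (?K \<times> ?K - (\<lambda>\<beta>. (- frob \<beta>, \<beta>)) ` ?K)" for x
  define B where "B = TB \<union> \<Union> (Fl x0 ` inf)"
  define A where "A x = GR x \<union> (TA x \<union> \<Union> (Fl x ` aff))" for x

  have frame_cb: "line_frame x1 x2 x3 (cb 1 0 0) (cb 0 1 0) (cb 0 0 1)"
    "line_frame x1 x2 x3 (cb 0 c 1) (cb 1 a 0) (cb 0 1 0)"
    "line_frame x1 x2 x3 (cb c 0 1) (cb 0 1 0) (cb 1 0 0)" for a c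
    unfolding line_frame_def by (auto simp: cb_def ac_comb_def add.commute)
  have T_mem: "latin_plane (\<Psi> x) \<phi> g h (to_ac t * e) \<in> A x \<union> B" if "line_frame x1 x2 x3 g h e" for x g h e t
    using that
  proof (cases rule: line_frame_cases)
    case 1
    have "latin_plane (\<Psi> x) \<phi> g h (to_ac t * e) = latin_plane (\<Psi> x0) \<phi> g h (to_ac t * e)"
      unfolding latin_plane_def 1 cb_def[symmetric] by (simp only: cb_x \<Psi>x)
    then show ?thesis using 1 unfolding B_def TB_def cb_def[symmetric] by blast
  next
    case (2 a c)
    have "latin_plane (\<Psi> x) \<phi> g h (to_ac t * e) \<in> TA x"
      unfolding TA_def 2 cb_def[symmetric] by (intro UnI1 image_eqI[of _ _ "(a, c, t)"]) auto
    then show ?thesis unfolding A_def by blast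
  next
    case (3 c)
    have "latin_plane (\<Psi> x) \<phi> g h (to_ac t * e) \<in> TA x"
      unfolding TA_def 3 cb_def[symmetric] by (intro UnI2 image_eqI[of _ _ "(c, t)"]) auto
    then show ?thesis unfolding A_def by blast
  qed
  have latin: "proj_subspace 2 (latin_plane (\<Psi> x) \<phi> g h b)"
    if "x \<notin> H" "g \<in> ?K" "h \<in> ?K" "b \<in> ?K" "line_frame x1 x2 x3 g h e" for x g h b e
    using latin_plane_plane[OF pp \<Psi> \<phi> P(1) \<phi>0 \<Psi>P[OF that(1)] that(2-4) line_frame_cross[OF ind that(5)]] .
  have latin_sub: "latin_plane (\<Psi> x) \<phi> g h b \<subseteq> U"
    if "vec.subspace U" "P \<subseteq> U" "g \<in> ?K" "h \<in> ?K" "b \<in> ?K" "\<Psi> x g \<in> U" "\<Psi> x h \<in> U" for x g h b U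
    using that \<phi>P cross_ext_field[OF pp] by (intro latin_plane_subset) blast+
  have tK: "to_ac t * cb a b c \<in> ?K" for t a b c by (intro ext_field_mult ext_field_to_ac cbK)
  have flag: "proj_subspace 2 E \<and> E \<subseteq> vec.span (insert (\<Psi> x k) P) \<and> \<not> E \<subseteq> P"
    if "x \<notin> H" "k \<in> aff \<union> inf" "E \<in> Fl x k" for x k E
    using flag_planes_planes[OF Qr(1)[OF pts[OF that(2)]] Qr(2)[OF pts[OF that(2)]], of "\<Psi> x k" E]
      \<Psi>P[OF that(1) pts(1)[OF that(2)]] pts(2)[OF that(2)] that(3) unfolding Fl_def by blast
  have card_Fl: "card (Fl x k) \<le> (?q - 1) + ?q ^ 2" for x k unfolding Fl_def by (rule card_flag_planes)

  have B_props: "proj_subspace 2 E \<and> E \<subseteq> H" if E: "E \<in> B" for E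
  proof (cases "E \<in> TB")
    case True
    then obtain t where Et: "E = latin_plane (\<Psi> x0) \<phi> (cb 1 0 0) (cb 0 1 0) (to_ac t * cb 0 0 1)"
      unfolding TB_def by blast
    have "\<Psi> x0 (cb 1 0 0) \<in> H" "\<Psi> x0 (cb 0 1 0) \<in> H" using w by (simp_all add: cb_x \<Psi>x)
    then show ?thesis
      unfolding Et by (intro conjI latin[OF x0 cbK cbK tK frame_cb(1)] latin_sub[OF H(1) P(3) cbK cbK tK])
  next
    case False
    then obtain k where k: "k \<in> inf" "E \<in> Fl x0 k" using E by (auto simp: B_def)
    have "vec.span (insert (\<Psi> x0 k) P) \<subseteq> H" using \<Psi>inf(1)[OF k(1)] P(3) H(1) by (intro vec.span_minimal) auto
    then show ?thesis using flag[OF x0 _ k(2)] k(1) by blast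
  qed
  have A_props: "proj_subspace 2 E \<and> E \<subseteq> vec.span (insert x H) \<and> \<not> E \<subseteq> H" if x: "x \<notin> H" and E: "E \<in> A x" for x E
  proof -
    have HS: "H \<subseteq> vec.span (insert x H)" by (auto intro: vec.span_base)
    then have PS: "P \<subseteq> vec.span (insert x H)" using P(3) by blast
    have \<Psi>S: "\<Psi> x k \<in> vec.span (insert x H)" if "k \<in> ?K" for k
    proof -
      obtain a b c where k: "k = cb a b c" using K_cb[OF \<open>k \<in> ?K\<close>] by blast
      have "w1 \<in> vec.span (insert x H)" "w2 \<in> vec.span (insert x H)" "x \<in> vec.span (insert x H)"
        using w by (auto intro: vec.span_base)
      then show ?thesis unfolding k \<Psi>cb by (intro vec.span_add vec.span_scale)
    qed
    have T: "proj_subspace 2 E \<and> E \<subseteq> vec.span (insert x H) \<and> \<not> E \<subseteq> H"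
      if ET: "E = latin_plane (\<Psi> x) \<phi> g h (to_ac t * e)" and fr: "line_frame x1 x2 x3 g h e"
        and ghe: "g \<in> ?K" "h \<in> ?K" "to_ac t * e \<in> ?K" and g: "g \<in> aff" for g h e t
    proof (intro conjI)
      show "proj_subspace 2 E" unfolding ET by (rule latin[OF x ghe fr])
      show "E \<subseteq> vec.span (insert x H)"
        unfolding ET using latin_sub[OF vec.subspace_span PS ghe] \<Psi>S ghe by blast
      have gH: "\<Psi> x g \<notin> H" using aff_points_notin(1)[OF H(1) w x \<Psi>aff[OF g]] .
      have sH: "\<phi> (cross (to_ac t * e) g) \<in> H" using \<phi>P cross_ext_field[OF pp] ghe P(3) by blast
      have "\<Psi> x g + \<phi> (cross (to_ac t * e) g) \<in> E" unfolding ET latin_plane_def by (simp add: vec.span_base)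
      moreover have "\<Psi> x g + \<phi> (cross (to_ac t * e) g) \<notin> H"
        using vec.subspace_diff[OF H(1) _ sH, of "\<Psi> x g + \<phi> (cross (to_ac t * e) g)"] gH by auto
      ultimately show "\<not> E \<subseteq> H" by blast
    qed
    have aff1: "cb a b 1 \<in> aff" for a b unfolding aff_def by (rule image_eqI[of _ _ "(a, b)"]) auto
    consider "E \<in> GR x" | "E \<in> TA x" | k where "k \<in> aff" "E \<in> Fl x k"
      using E unfolding A_def by blast
    then show ?thesis
    proof cases
      case 1
      then obtain \<alpha> \<beta> where ab: "\<alpha> \<in> ?K" "\<beta> \<in> ?K" and EG: "E = graph_plane \<phi> w1 w2 x x1 x2 x3 \<alpha> \<beta>"
        by (auto simp: GR_def)
      show ?thesis
        unfolding EG using graph_plane_plane[OF pp im[OF x] P(1) equalityD1[OF \<phi>(2)] K ab H(1) P(3) w x] by blast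
    next
      case 2
      then consider a c t where "E = latin_plane (\<Psi> x) \<phi> (cb 0 c 1) (cb 1 a 0) (to_ac t * cb 0 1 0)"
        | c t where "E = latin_plane (\<Psi> x) \<phi> (cb c 0 1) (cb 0 1 0) (to_ac t * cb 1 0 0)"
        unfolding TA_def by auto
      then show ?thesis
      proof cases
        case 1
        then show ?thesis by (rule T[OF _ frame_cb(2) cbK cbK tK aff1])
      next
        case 2
        then show ?thesis by (rule T[OF _ frame_cb(3) cbK cbK tK aff1])
      qed
    next
      case 3
      note yH = aff_points_notin[OF H(1) w x \<Psi>aff[OF 3(1)]]
      note E' = flag[OF x UnI1[OF 3(1)] 3(2)]
      have "vec.span (insert (\<Psi> x k) P) \<subseteq> vec.span (insert x H)"
        using yH(2) PS by (intro vec.span_minimal vec.subspace_span) auto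
      moreover have "\<not> E \<subseteq> H" using span_insert_meet[OF P(1) H(1) P(3) yH(1)] E' by blast
      ultimately show ?thesis using E' by blast
    qed
  qed

  \<comment> \<open>The count is q + (q + 1)(q^2 + q - 1) = (q + 1)(q^2 + q) - 1.\<close>
  have card_B: "card B \<le> inf_count ?q 3"
  proof -
    have "card TB \<le> ?q" unfolding TB_def by (rule card_image_le) simp
    moreover have "card (\<Union> (Fl x0 ` inf)) \<le> (?q + 1) * ((?q - 1) + ?q ^ 2)"
      by (intro card_UN_bound card_inf card_Fl) (simp add: inf_def)
    ultimately have "card B \<le> ?q + (?q + 1) * ((?q - 1) + ?q ^ 2)"
      unfolding B_def using card_Un_le[of TB "\<Union> (Fl x0 ` inf)"] by linarith
    moreover have "?q + ?q ^ 2 = ((?q - 1) + ?q ^ 2) + 1" using q1 by simp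
    then have "(?q + 1) * (?q + ?q ^ 2) = (?q + 1) * ((?q - 1) + ?q ^ 2) + (?q + 1)"
      by (simp only: distrib_left mult_1_right)
    ultimately show ?thesis unfolding inf_count_3 by linarith
  qed
  \<comment> \<open>The count is (q^6 - q^3) + (q^3 + q^2) + q^2 (q^2 + q - 1) = q^6 + q^4 +
    q^3.\<close>
  have card_A: "card (A x) \<le> aff_count ?q 3" for x
  proof -
    have finK: "finite ?K" by (rule finite_ext_field[OF pp]) simp
    have cK: "card ?K = ?q ^ 3" by (rule card_ext_field[OF pp]) simp
    have "card (GR x) \<le> card (?K \<times> ?K - (\<lambda>\<beta>. (- frob \<beta>, \<beta>)) ` ?K)"
      unfolding GR_def by (intro card_image_le finite_Diff finite_cartesian_product finK)
    also have "\<dots> = card (?K \<times> ?K) - card ((\<lambda>\<beta>. (- frob \<beta>, \<beta>)) ` ?K)"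
      by (intro card_Diff_subset finite_imageI finK) (auto intro: ext_field_minus ext_field_power)
    also have "card ((\<lambda>\<beta>. (- frob \<beta>, \<beta>)) ` ?K) = ?q ^ 3" by (subst card_image) (auto simp: inj_on_def cK)
    also have "card (?K \<times> ?K) = ?q ^ 6" by (simp only: card_cartesian_product cK power_add[symmetric]) simp
    finally have "card (GR x) \<le> ?q ^ 6 - ?q ^ 3" .
    moreover have "?q ^ 3 \<le> ?q ^ 6" using q1 by (intro power_increasing) auto
    moreover have "card (TA x) \<le> ?q ^ 3 + ?q ^ 2"
      unfolding TA_def
      by (intro card_Un_le[THEN le_trans] add_mono card_image_le[THEN le_trans])
        (auto simp: power2_eq_square power3_eq_cube)
    moreover have "card (\<Union> (Fl x ` aff)) \<le> ?q ^ 2 * ((?q - 1) + ?q ^ 2)"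
      by (intro card_UN_bound card_aff card_Fl) (simp add: aff_def)
    moreover have "?q ^ 2 * ((?q - 1) + ?q ^ 2) + ?q ^ 2 = ?q ^ 3 + ?q ^ 4"
    proof -
      have "?q ^ 2 * (?q - 1) + ?q ^ 2 = ?q ^ 2 * ((?q - 1) + 1)" by (simp only: distrib_left mult_1_right)
      also have "\<dots> = ?q ^ 3" using q1 by (simp add: power2_eq_square power3_eq_cube)
      finally have "?q ^ 2 * (?q - 1) + ?q ^ 2 = ?q ^ 3" .
      moreover have "?q ^ 2 * ?q ^ 2 = ?q ^ 4" by (simp flip: power_add)
      ultimately show ?thesis unfolding distrib_left by linarith
    qed
    moreover have "card (A x) \<le> card (GR x) + (card (TA x) + card (\<Union> (Fl x ` aff)))"
      unfolding A_def by (meson add_left_mono card_Un_le le_trans)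
    ultimately show ?thesis unfolding aff_count_3 by linarith
  qed

  have cov: "covers (A x \<union> B) (vec.span (insert x H))" if x: "x \<notin> H" for x
    unfolding covers_def
  proof (intro ballI)
    fix u v assume uv: "u \<in> vec.span (insert x H)" "v \<in> vec.span (insert x H)"
    have sub: "vec.subspace E" if "E \<in> A x \<union> B" for E
      using that A_props[OF x] B_props by (auto simp: proj_subspace_def)
    have Fl_mem: "Fl x k \<subseteq> A x \<union> B" if k: "k \<in> aff \<union> inf" for k
      using k \<Psi>inf(2)[of k x] unfolding A_def B_def Fl_def by auto
    have coords: "\<exists>k s. k \<in> ?K \<and> s \<in> ?K \<and> y = \<Psi> x k + \<phi> s" if y: "y \<in> vec.span (insert x H)" for y
    proof -
      obtain a b c p where "p \<in> P" "y = a *s w1 + b *s w2 + c *s x + p"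
        using split_decomposition[OF P(1) H(1) split y] by metis
      moreover then obtain s where "s \<in> ?K" "p = \<phi> s" using \<phi>(2) by blast
      ultimately show ?thesis using cbK \<Psi>cb by metis
    qed
    obtain k s where u: "k \<in> ?K" "s \<in> ?K" "u = \<Psi> x k + \<phi> s" using coords[OF uv(1)] by blast
    obtain l t where v: "l \<in> ?K" "t \<in> ?K" "v = \<Psi> x l + \<phi> t" using coords[OF uv(2)] by blast
    have point: "\<exists>g d d'. g \<in> aff \<union> inf \<and> m = to_ac d * g \<and> m' = to_ac d' * g"
      if mm: "m \<in> ?K" "m' \<in> ?K" "cross m m' = 0" for m m'
    proof -
      obtain g d d' where g: "(\<exists>a b. g = cb a b 1) \<or> (\<exists>a. g = cb 1 a 0) \<or> g = cb 0 1 0"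
        "m = to_ac d * g" "m' = to_ac d' * g"
        using ac_proportional_common_point[OF pp K ind mm] unfolding cb_def by metis
      have "g \<in> aff \<union> inf" using g(1) unfolding aff_def inf_def by auto
      then show ?thesis using g by blast
    qed
    \<comment> \<open>A line inside \<open>P\<close> meets the line of the
      \<open>\<phi> (cross x1 m)\<close> in a point, which up to a scalar is \<open>p g\<close> for
      some normalised \<open>g\<close>. Some plane of \<open>Fl x g\<close> joins \<open>p g\<close>
      to a further vector of the line.\<close>
    have in_rho: "\<exists>E\<in>A x \<union> B. u' \<in> E \<and> v' \<in> E" if uvP: "u' \<in> P" "v' \<in> P" for u' v'
    proof -
      have x1: "cross x1 x2 \<noteq> 0" using line_frame_cross[OF ind frame_cb(1)] by (simp add: cb_x)
      obtain a b m where m: "a \<noteq> 0 \<or> b \<noteq> 0" "m \<in> ?K" "a *s u' + b *s v' = \<phi> (cross x1 m)"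
        using pencil_meets_line[OF pp \<phi> \<phi>0 K(1) K(2) x1 uvP] by metis
      have "\<exists>g e. g \<in> aff \<union> inf \<and> \<phi> (cross x1 m) = e *s p g"
      proof (cases "cross x1 m = 0")
        case True
        then have "\<phi> (cross x1 m) = 0 *s p (cb 0 1 0)" by (simp add: ac_linear_0[OF \<phi>(1)])
        then show ?thesis unfolding inf_def by blast
      next
        case False
        obtain g d where g: "g \<in> aff \<union> inf" "m = to_ac d * g" using point[OF m(2) m(2)] by auto
        have "cross x1 g \<noteq> 0" using False by (auto simp: g cross_scale)
        then have "j g = x1" using cross_swap[of g x1] by (simp add: j_def)
        then have "\<phi> (cross x1 m) = (- d) *s p g"
          unfolding p_def g(2) by (simp add: cross_scale ac_linear_scale[OF \<phi>(1)] cross_swap[of x1 g] ac_linear_minus[OF \<phi>(1)])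
        then show ?thesis using g(1) by blast
      qed
      then obtain g e where g: "g \<in> aff \<union> inf" "a *s u' + b *s v' = e *s p g" using m(3) by metis
      have through: "\<exists>E\<in>Fl x g. p g \<in> E \<and> w \<in> E" if "w \<in> P" for w
        unfolding Fl_def
        using flag_planes_through[OF Qr(1)[OF pts[OF g(1)]] Qr(2)[OF pts[OF g(1)]] _ that, of "\<Psi> x g"]
          \<Psi>P[OF x pts(1)[OF g(1)]] pts(2)[OF g(1)] by blast
      have solve: "w \<in> E" if "vec.subspace E" "p g \<in> E" "w' \<in> E" "c *s w + c' *s w' = e *s p g" "c \<noteq> 0"
        for E w w' c c'
      proof -
        have "c *s w = e *s p g - c' *s w'" using that(4) by (simp add: eq_diff_eq)
        also have "\<dots> \<in> E" using that by (intro vec.subspace_diff vec.subspace_scale)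
        finally show ?thesis using subspace_scale_cancel[OF that(1)] that(5) by blast
      qed
      show ?thesis
      \<comment> \<open>A vector with nonzero coefficient is recovered from \<open>p g\<close> and
        the other vector, so the plane is chosen through \<open>p g\<close> and that other
        one.\<close>
      proof (cases "a = 0")
        case True
        obtain E where E: "E \<in> Fl x g" "p g \<in> E" "u' \<in> E" using through[OF uvP(1)] by blast
        have EAB: "E \<in> A x \<union> B" using Fl_mem[OF g(1)] E(1) by blast
        have "v' \<in> E" using solve[OF sub[OF EAB] E(2,3), of b v' a] g(2) m(1) True by (simp add: add.commute)
        then show ?thesis using EAB E by blast
      next
        case False
        obtain E where E: "E \<in> Fl x g" "p g \<in> E" "v' \<in> E" using through[OF uvP(2)] by blast
        have EAB: "E \<in> A x \<union> B" using Fl_mem[OF g(1)] E(1) by blast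
        have "u' \<in> E" using solve[OF sub[OF EAB] E(2,3) g(2) False] .
        then show ?thesis using EAB E by blast
      qed
    qed
    \<comment> \<open>These pairs lie in the plane omitted by \<open>Fl x g\<close> and are not both
      in \<open>P\<close>; planes of the Klein quadric over lines through \<open>g\<close> cover
      them.\<close>
    have in_sigma: "\<exists>E\<in>A x \<union> B. u' \<in> E \<and> v' \<in> E"
      if g: "g \<in> aff \<union> inf" and u': "u' = d *s \<Psi> x g + \<phi> (cross g m)" "m \<in> ?K"
        and v': "v' = d' *s \<Psi> x g + \<phi> (cross g m')" "m' \<in> ?K" and d: "d \<noteq> 0" for g d m d' m' u' v'
    proof -
      note gK = pts[OF g]
      \<comment> \<open>\<open>b\<close> is chosen such that
        \<open>u' = d *s (\<Psi> x g + \<phi> (cross b g))\<close>, and \<open>n\<close> such that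
        \<open>v'\<close> differs from \<open>(d' / d) *s u'\<close> by
        \<open>\<phi> (cross g n)\<close>. If \<open>cross g n\<close> vanishes, \<open>j g\<close>
        stands in for \<open>n\<close>, since \<open>latin_plane_cover\<close> needs a genuine line
        through \<open>g\<close>.\<close>
      define b where "b = to_ac (- inverse d) * m"
      define n where "n = m' - to_ac (d' / d) * m"
      define n' where "n' = (if cross g n = 0 then j g else n)"
      have bK: "b \<in> ?K" unfolding b_def by (intro ext_field_mult ext_field_to_ac u'(2))
      have nK: "n \<in> ?K" unfolding n_def by (intro ext_field_diff pp ext_field_mult ext_field_to_ac u'(2) v'(2))
      have n': "n' \<in> ?K" "cross g n' \<noteq> 0" using nK jK jk[OF gK] by (auto simp: n'_def)
      obtain f h e t where fr: "line_frame x1 x2 x3 f h e"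
        and E: "\<Psi> x g + \<phi> (cross b g) \<in> latin_plane (\<Psi> x) \<phi> f h (to_ac t * e)"
          "\<phi> (cross g n') \<in> latin_plane (\<Psi> x) \<phi> f h (to_ac t * e)"
        using latin_plane_cover[OF pp \<Psi> \<phi>(1) K ind gK(1) n'(1) bK n'(2)] by metis
      define E where "E = latin_plane (\<Psi> x) \<phi> f h (to_ac t * e)"
      have EAB: "E \<in> A x \<union> B" unfolding E_def by (rule T_mem[OF fr])
      note sE = sub[OF EAB]
      have "cross b g = to_ac (inverse d) * cross g m"
        unfolding b_def cross_scale cross_swap[of m g] by simp
      then have "\<phi> (cross b g) = inverse d *s \<phi> (cross g m)" by (simp only: ac_linear_scale[OF \<phi>(1)])
      then have "u' = d *s (\<Psi> x g + \<phi> (cross b g))"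
        using d by (simp add: u' vec.scale_right_distrib vector_smult_assoc)
      then have uE: "u' \<in> E" using E(1) sE unfolding E_def by (simp only: vec.subspace_scale)
      have nE: "\<phi> (cross g n) \<in> E"
      proof (cases "cross g n = 0")
        case True
        then show ?thesis using vec.subspace_0[OF sE] by (simp add: ac_linear_0[OF \<phi>(1)])
      next
        case False
        then show ?thesis using E(2) by (simp add: n'_def E_def)
      qed
      have "cross g m' = cross g n + to_ac (d' / d) * cross g m"
      proof -
        have "m' = n + to_ac (d' / d) * m" by (simp add: n_def)
        then show ?thesis by (simp only: cross_add[OF pp] cross_scale)
      qed
      then have "\<phi> (cross g m') = \<phi> (cross g n) + (d' / d) *s \<phi> (cross g m)"
        by (simp only: ac_linear_add[OF \<phi>(1)] ac_linear_scale[OF \<phi>(1)])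
      then have "v' = (d' / d) *s u' + \<phi> (cross g n)"
        using d by (simp add: u' v' vec.scale_right_distrib vector_smult_assoc)
      also have "\<dots> \<in> E" using uE nE sE by (intro vec.subspace_add vec.subspace_scale)
      finally show ?thesis using EAB uE by blast
    qed
    show "\<exists>E\<in>A x \<union> B. u \<in> E \<and> v \<in> E"
    proof (cases "cross k l = 0")
      case False
      obtain \<alpha> \<beta> where ab: "\<alpha> \<in> ?K" "\<beta> \<in> ?K" "\<alpha> * k + \<beta> * frob k = s" "\<alpha> * l + \<beta> * frob l = t"
        using linearised_interpolation[OF pp u(1) v(1) u(2) v(2) False] by metis
      show ?thesis
      \<comment> \<open>In the first case the interpolating graph is one of those left out of
        \<open>GR\<close>; the values are \<open>cross \<beta> k\<close> and
        \<open>cross \<beta> l\<close>, so a latin plane contains both vectors.\<close>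
      proof (cases "\<alpha> = - frob \<beta>")
        case True
        have st: "s = cross \<beta> k" "t = cross \<beta> l"
          using ab(3,4) unfolding True cross_def by (simp_all only: mult_minus_left diff_conv_add_uminus add.commute)
        obtain f h e c where fr: "line_frame x1 x2 x3 f h e"
          and uv': "\<Psi> x k + \<phi> (cross \<beta> k) \<in> latin_plane (\<Psi> x) \<phi> f h (to_ac c * e)"
          "\<Psi> x l + \<phi> (cross \<beta> l) \<in> latin_plane (\<Psi> x) \<phi> f h (to_ac c * e)"
          using latin_plane_cover[OF pp \<Psi> \<phi>(1) K ind u(1) v(1) ab(2) False] by metis
        show ?thesis
          by (rule bexI[OF _ T_mem[OF fr, of x c]]) (use uv' in \<open>simp only: u(3) v(3) st simp_thms\<close>)
      next
        case False
        obtain a b c where k: "k = cb a b c" using K_cb[OF u(1)] by blast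
        obtain a' b' c' where l: "l = cb a' b' c'" using K_cb[OF v(1)] by blast
        have "u \<in> graph_plane \<phi> w1 w2 x x1 x2 x3 \<alpha> \<beta>"
          unfolding u(3) k \<Psi>cb by (rule graph_plane_contains[OF pp \<phi>(1) ab(3)[unfolded k cb_def]])
        moreover have "v \<in> graph_plane \<phi> w1 w2 x x1 x2 x3 \<alpha> \<beta>"
          unfolding v(3) l \<Psi>cb by (rule graph_plane_contains[OF pp \<phi>(1) ab(4)[unfolded l cb_def]])
        moreover have "graph_plane \<phi> w1 w2 x x1 x2 x3 \<alpha> \<beta> \<in> GR x"
          unfolding GR_def using ab(1,2) False by (intro image_eqI[of _ _ "(\<alpha>, \<beta>)"]) auto
        ultimately show ?thesis unfolding A_def by blast
      qed
    next
      case True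
      obtain g d d' where g: "g \<in> aff \<union> inf" "k = to_ac d * g" "l = to_ac d' * g"
        using point[OF u(1) v(1) True] by blast
      note gK = pts[OF g(1)]
      have ud: "u - d *s \<Psi> x g \<in> P" and vd: "v - d' *s \<Psi> x g \<in> P"
        using \<phi>P u(2) v(2) by (simp_all add: u(3) v(3) g ac_linear_scale[OF \<Psi>])
      show ?thesis
      proof (cases "d = 0 \<and> d' = 0")
        case True
        then show ?thesis using in_rho[of u v] ud vd by simp
      next
        case False
        have yP: "\<Psi> x g \<notin> P" using \<Psi>P[OF x gK(1)] gK(2) by blast
        consider E where "E \<in> Fl x g" "u \<in> E" "v \<in> E"
          | "u \<in> vec.span {\<Psi> x g, p g, Q g}" "v \<in> vec.span {\<Psi> x g, p g, Q g}"
          using flag_planes_cover[OF Qr(1)[OF gK] Qr(2)[OF gK] yP ud vd] False unfolding Fl_def by blast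
        then show ?thesis
        proof cases
          case 1
          then show ?thesis using Fl_mem[OF g(1)] by blast
        next
          case 2
          have dec: "\<exists>c m. m \<in> ?K \<and> y = c *s \<Psi> x g + \<phi> (cross g m)" if y: "y \<in> vec.span {\<Psi> x g, p g, Q g}" for y
          proof -
            obtain c where "y - c *s \<Psi> x g \<in> vec.span {p g, Q g}" using y unfolding vec.span_breakdown_eq[of y "\<Psi> x g"] by blast
            then obtain m where "m \<in> ?K" "y - c *s \<Psi> x g = \<phi> (cross g m)" unfolding Qr(3)[OF gK] by blast
            then show ?thesis by (intro exI[of _ c] exI[of _ m]) (simp add: diff_eq_eq add.commute)
          qed
          obtain c m where um: "m \<in> ?K" "u = c *s \<Psi> x g + \<phi> (cross g m)" using dec[OF 2(1)] by blast
          obtain c' m' where vm: "m' \<in> ?K" "v = c' *s \<Psi> x g + \<phi> (cross g m')" using dec[OF 2(2)] by blast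
          consider "c \<noteq> 0" | "c' \<noteq> 0" | "c = 0" "c' = 0" by blast
          then show ?thesis
          proof cases
            case 1
            then show ?thesis using in_sigma[OF g(1) um(2,1) vm(2,1)] by blast
          next
            case 2
            then show ?thesis using in_sigma[OF g(1) vm(2,1) um(2,1)] by blast
          next
            case 3
            have "u = \<phi> (cross g m)" "v = \<phi> (cross g m')" using um(2) vm(2) 3 by simp_all
            then show ?thesis
              using in_rho \<phi>P[OF cross_ext_field[OF pp gK(1) um(1)]] \<phi>P[OF cross_ext_field[OF pp gK(1) vm(1)]] by metis
          qed
        qed
      qed
    qed
  qed
  show ?thesis
    unfolding coverable_def
  proof (rule exI[of _ B], intro conjI allI impI)
    show "card B \<le> inf_count ?q 3" by (rule card_B)
    show "\<forall>E\<in>B. proj_subspace 2 E \<and> E \<subseteq> H" using B_props by blast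
    fix x assume x: "x \<notin> H"
    have "\<forall>E\<in>A x. proj_subspace 2 E \<and> E \<subseteq> vec.span (insert x H) \<and> \<not> E \<subseteq> H"
      using A_props[OF x] by blast
    then show "\<exists>A. card A \<le> aff_count ?q 3 \<and>
        (\<forall>E\<in>A. proj_subspace 2 E \<and> E \<subseteq> vec.span (insert x H) \<and> \<not> E \<subseteq> H) \<and>
        covers (A \<union> B) (vec.span (insert x H))"
      using card_A[of x] cov[OF x] by (intro exI[of _ "A x"] conjI)
  qed
qed

section \<open>The covering design\<close>

lemma coverable_hyperplane:
  fixes H :: "('a::{field,finite} ^ 'n::finite) set"
  assumes pp: "primepow CARD('a)" and "m \<ge> 3" "vec.subspace H" "vec.dim H = 2 * m - 1"
  shows "coverable m H"
  using assms(2-)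
proof (induction m arbitrary: H rule: dec_induct)
  case base
  then show ?case by (intro coverable_base[OF pp]) auto
next
  case (step m)
  show ?case
  proof (rule coverable_step[OF pp])
    show "vec.dim H = 2 * m + 1" using step.prems(2) by simp
  qed (use step in auto)
qed

section \<open>Enough planes for padding to the exact numbers\<close>

text \<open>A crude bound, resting on q + 1 \<le> q^2 in each step of the recursion, to be compared
  with the number of all planes off the hyperplane.\<close>

lemma aff_count_le:
  assumes "q \<ge> 2" "m \<ge> 2"
  shows "aff_count q m \<le> q ^ (4 * m - 5)"
  using assms(2)
proof (induction m rule: dec_induct)
  case base
  have "1 + q \<le> q ^ 2" using assms(1) by (cases q) (auto simp: power2_eq_square)
  then have "q * (1 + q) \<le> q * q ^ 2" by (rule mult_le_mono2)
  then show ?case by (simp add: aff_count_def eval_nat_numeral algebra_simps)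
next
  case (step m)
  define k where "k = 4 * m - 5"
  have k: "2 * (2 * m - 1) = k + 3" "4 * Suc m - 5 = k + 4" using step.hyps by (auto simp: k_def)
  have "aff_count q (Suc m) \<le> q ^ (k + 3) + q ^ 2 * q ^ k"
    unfolding aff_count_Suc[OF step.hyps(1)] k(1) using step.IH by (simp add: k_def)
  also have "\<dots> = q ^ (k + 2) * (q + 1)" by (simp add: power_add power2_eq_square power3_eq_cube algebra_simps)
  also have "\<dots> \<le> q ^ (k + 2) * q ^ 2"
    using assms(1) by (intro mult_le_mono2) (cases q, auto simp: power2_eq_square)
  also have "\<dots> = q ^ (k + 2 + 2)" by (simp only: power_add)
  also have "k + 2 + 2 = 4 * Suc m - 5" unfolding k(2) by simp
  finally show ?case .
qed

text \<open>The recursion adds at most (q + 1) q^(4m - 5), while the bound gains a factor q^4 in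
  each step.\<close>

lemma inf_count_le:
  assumes "q \<ge> 2" "m \<ge> 3"
  shows "inf_count q m \<le> q ^ (4 * m - 6)"
  using assms(2)
proof (induction m rule: dec_induct)
  case base
  have q: "q + 1 \<le> q ^ 2" using assms(1) by (cases q) (auto simp: power2_eq_square)
  have "(q + 1) * (q + q ^ 2) = q * ((q + 1) * (q + 1))" by (simp add: algebra_simps power2_eq_square)
  also have "\<dots> \<le> q ^ 2 * (q ^ 2 * q ^ 2)" using q by (intro mult_le_mono) auto
  also have "\<dots> = q ^ 6" by (simp flip: power_add)
  finally show ?case by (simp add: inf_count_3)
next
  case (step m)
  define k where "k = 4 * m - 6"
  have k: "4 * m - 5 = k + 1" "4 * Suc m - 6 = k + 4" using step.hyps by (auto simp: k_def)
  have q: "q + 1 \<le> q ^ 2" using assms(1) by (cases q) (auto simp: power2_eq_square)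
  have "aff_count q m \<le> q ^ (k + 1)" using aff_count_le[OF assms(1), of m] step.hyps by (simp add: k)
  then have "inf_count q (Suc m) \<le> (q + 1) * q ^ (k + 1) + q ^ k"
    using step.IH step.hyps(1) assms(1) unfolding k_def[symmetric]
    by (subst inf_count_Suc) (auto intro!: add_mono mult_le_mono2)
  also have "\<dots> \<le> q ^ k * ((q + 1) * (q + 1))" by (simp add: algebra_simps)
  also have "\<dots> \<le> q ^ k * (q ^ 2 * q ^ 2)" using q by (intro mult_le_mono) auto
  also have "\<dots> = q ^ (4 * Suc m - 6)" unfolding k by (simp flip: power_add)
  finally show ?case .
qed

text \<open>The linear maps from the span of \<open>w1\<close>, \<open>w2\<close>, \<open>x\<close>
  to the \<open>N\<close>-dimensional \<open>P\<close> have q^(3N) distinct graphs, none of them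
  inside \<open>U\<close>.\<close>

lemma card_planes_off_hyperplane:
  fixes U :: "('a::{field,finite} ^ 'n::finite) set"
  assumes U: "vec.subspace U" "vec.dim U = N + 2" and x: "x \<notin> U"
  shows "CARD('a) ^ (3 * N) \<le> card {E. proj_subspace 2 E \<and> E \<subseteq> vec.span (insert x U) \<and> \<not> E \<subseteq> U}"
proof -
  obtain P w1 w2 where P: "vec.subspace P" "vec.dim P = N" "P \<subseteq> U" and w: "w1 \<in> U" "w2 \<in> U"
    and im: "indep_mod P w1 w2 x"
    using subspace_split2[OF U] x by metis
  let ?f = "\<lambda>(p, p', p''). vec.span {w1 + p, w2 + p', x + p''}"
  have "proj_subspace 2 (?f t) \<and> ?f t \<subseteq> vec.span (insert x U) \<and> \<not> ?f t \<subseteq> U" if t: "t \<in> P \<times> P \<times> P" for t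
  proof -
    obtain p p' p'' where t': "t = (p, p', p'')" "p \<in> P" "p' \<in> P" "p'' \<in> P" using t by blast
    have US: "U \<subseteq> vec.span (insert x U)" by (auto intro: vec.span_base)
    have xS: "x \<in> vec.span (insert x U)" by (simp add: vec.span_base)
    have "vec.span {w1 + p, w2 + p', x + p''} \<subseteq> vec.span (insert x U)"
      using t'(2-) w P(3) US xS by (intro vec.span_minimal vec.subspace_span) (auto intro!: vec.span_add)
    moreover have "x + p'' \<in> vec.span {w1 + p, w2 + p', x + p''}" by (simp add: vec.span_base)
    moreover have "x + p'' \<notin> U" using vec.subspace_diff[OF U(1), of "x + p''" p''] t'(4) P(3) x by auto
    ultimately show ?thesis
      using proj_plane_span3[OF indep_mod_graph[OF im P(1) t'(2-4)]] unfolding t'(1) by auto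
  qed
  then have "?f ` (P \<times> P \<times> P) \<subseteq> {E. proj_subspace 2 E \<and> E \<subseteq> vec.span (insert x U) \<and> \<not> E \<subseteq> U}" by blast
  then have "card (?f ` (P \<times> P \<times> P)) \<le> card {E. proj_subspace 2 E \<and> E \<subseteq> vec.span (insert x U) \<and> \<not> E \<subseteq> U}"
    by (intro card_mono) auto
  moreover have "card (?f ` (P \<times> P \<times> P)) = card (P \<times> P \<times> P)"
    by (rule card_image[OF indep_mod_graph_inj[OF im P(1)]])
  moreover have "card (P \<times> P \<times> P) = CARD('a) ^ (3 * N)"
  proof -
    have "3 * N = N + (N + N)" by simp
    then show ?thesis by (simp only: card_cartesian_product card_subspace[OF P(1)] P(2) power_add)
  qed
  ultimately show ?thesis by simp
qed

theorem theorem3p4: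
  fixes q n :: nat
  assumes "primepow q"
    and "n \<ge> 3"
    and "CARD('a::{field,finite}) = q"
    and "CARD('n::finite) = 2 * n"
  shows "\<exists>(X :: ('a ^ 'n) set set) (\<Gamma> :: ('a ^ 'n) set).
           q_covering_design 3 2 X \<and> proj_hyperplane \<Gamma> \<and>
           card {U \<in> X. \<not> U \<subseteq> \<Gamma>}
             = q ^ (2 * n - 3) + (\<Sum>j = 0..n - 2. q ^ (2 * (n + j - 1))) \<and>
           card {U \<in> X. U \<subseteq> \<Gamma>}
             = (q + 1) * (\<Sum>i = 2..n - 1. q ^ (2 * i - 3)
                            + (\<Sum>j = 0..i - 2. q ^ (2 * (i + j - 1)))) - 1"
proof -
  have pp: "primepow CARD('a)" and q: "q \<ge> 2"
    using assms(1,3) CARD_field_gt_1[where ?'a = 'a] by simp_all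
  have "vec.dim (UNIV :: ('a ^ 'n) set) = Suc (2 * n - 1)" using assms(2,4) by (simp add: vec.dim_UNIV card_cart_basis)
  then obtain \<Gamma> :: "('a ^ 'n) set" and x where \<Gamma>: "vec.subspace \<Gamma>" "vec.dim \<Gamma> = 2 * n - 1" and x: "x \<notin> \<Gamma>"
    and split: "\<And>v. \<exists>a. v - a *s x \<in> \<Gamma>"
    using subspace_split1[OF vec.subspace_UNIV] by (metis UNIV_I)
  have span_UNIV: "vec.span (insert x \<Gamma>) = UNIV" using split span_insert_subspace[OF \<Gamma>(1)] by blast
  let ?P = "{E. proj_subspace 2 E \<and> \<not> E \<subseteq> \<Gamma>}" and ?Q = "{E. proj_subspace 2 E \<and> E \<subseteq> \<Gamma>}"
  obtain B where B': "card B \<le> inf_count q n" "\<forall>E\<in>B. proj_subspace 2 E \<and> E \<subseteq> \<Gamma>"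
    and "\<forall>x. x \<notin> \<Gamma> \<longrightarrow> (\<exists>A. card A \<le> aff_count q n \<and>
        (\<forall>E\<in>A. proj_subspace 2 E \<and> E \<subseteq> vec.span (insert x \<Gamma>) \<and> \<not> E \<subseteq> \<Gamma>) \<and>
        covers (A \<union> B) (vec.span (insert x \<Gamma>)))"
    using coverable_hyperplane[OF pp assms(2) \<Gamma>] unfolding coverable_def assms(3) by (elim exE conjE)
  then obtain A where A': "card A \<le> aff_count q n" "\<forall>E\<in>A. proj_subspace 2 E \<and> E \<subseteq> UNIV \<and> \<not> E \<subseteq> \<Gamma>"
    and cov: "covers (A \<union> B) UNIV"
    unfolding span_UNIV[symmetric] using x by (elim allE[of _ x] impE exE conjE)
  have A: "card A \<le> aff_count q n" "A \<subseteq> ?P" and B: "card B \<le> inf_count q n" "B \<subseteq> ?Q"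
    using A' B' by auto
  \<comment> \<open>Since 4n - 5 \<le> 3(2n - 3), there are enough planes off \<Gamma> to enlarge
    \<open>A\<close> to the exact number.\<close>
  have "aff_count q n \<le> q ^ (4 * n - 5)" by (rule aff_count_le) (use q assms(2) in auto)
  also have "\<dots> \<le> q ^ (3 * (2 * n - 3))" using q assms(2) by (intro power_increasing) auto
  also have "\<dots> \<le> card ?P"
    using card_planes_off_hyperplane[OF \<Gamma>(1) _ x, of "2 * n - 3"] \<Gamma>(2) assms(2,3) by (simp add: span_UNIV)
  finally obtain A' where A': "A \<subseteq> A'" "A' \<subseteq> ?P" "card A' = aff_count q n"
    using exists_subset_between[OF A(1) _ A(2)] by auto
  \<comment> \<open>Planes inside \<Gamma> are counted off a hyperplane \<Delta> of \<Gamma>. The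
    comparison 4n - 6 \<le> 3(2n - 4) holds from n = 3 on, with equality there.\<close>
  have "vec.dim \<Gamma> = Suc (2 * n - 2)" using \<Gamma>(2) assms(2) by simp
  then obtain \<Delta> y where \<Delta>: "vec.subspace \<Delta>" "vec.dim \<Delta> = 2 * n - 2" "\<Delta> \<subseteq> \<Gamma>" and y: "y \<in> \<Gamma>" "y \<notin> \<Delta>"
    using subspace_split1[OF \<Gamma>(1)] by metis
  have "inf_count q n \<le> q ^ (4 * n - 6)" by (rule inf_count_le) (use q assms(2) in auto)
  also have "\<dots> \<le> q ^ (3 * (2 * n - 4))" using q assms(2) by (intro power_increasing) auto
  also have "\<dots> \<le> card {E. proj_subspace 2 E \<and> E \<subseteq> vec.span (insert y \<Delta>) \<and> \<not> E \<subseteq> \<Delta>}"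
    using card_planes_off_hyperplane[OF \<Delta>(1) _ y(2), of "2 * n - 4"] \<Delta>(2) assms(2,3) by simp
  also have "\<dots> \<le> card ?Q"
  proof -
    have "vec.span (insert y \<Delta>) \<subseteq> \<Gamma>" using \<Delta>(3) y(1) \<Gamma>(1) by (intro vec.span_minimal) auto
    then show ?thesis by (intro card_mono) auto
  qed
  finally obtain B' where B': "B \<subseteq> B'" "B' \<subseteq> ?Q" "card B' = inf_count q n"
    using exists_subset_between[OF B(1) _ B(2)] by auto
  have "q_covering_design 3 2 (A' \<union> B')"
    unfolding q_covering_design_def
  proof (intro conjI allI impI ballI)
    show "3 \<le> CARD('n)" using assms(2,4) by simp
    show "proj_subspace (3 - 1) U" if "U \<in> A' \<union> B'" for U using that A'(2) B'(2) by auto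
    \<comment> \<open>A line has a basis of two vectors, and a member of the system containing both
      contains the line.\<close>
    fix W :: "('a ^ 'n) set" assume "proj_subspace (2 - 1) W"
    then have "vec.dim W = 2" by (simp add: proj_subspace_def)
    then obtain C where C: "W \<subseteq> vec.span C" "card C = 2" using vec.basis_exists[of W] by metis
    then obtain u v where "C = {u, v}" by (meson card_2_iff)
    moreover obtain E where E: "E \<in> A \<union> B" "u \<in> E" "v \<in> E" using cov unfolding covers_def by blast
    moreover have "vec.subspace E" using E(1) A(2) B(2) by (auto simp: proj_subspace_def)
    ultimately have "vec.span C \<subseteq> E" by (intro vec.span_minimal) auto
    then show "\<exists>U\<in>A' \<union> B'. W \<subseteq> U" using C(1) E(1) A'(1) B'(1) by blast
  qed simp_all
  moreover have "proj_hyperplane \<Gamma>"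
    unfolding proj_hyperplane_def proj_subspace_def using \<Gamma> assms(2,4) by (intro exI[of _ "2 * n - 2"]) auto
  moreover have "{U \<in> A' \<union> B'. \<not> U \<subseteq> \<Gamma>} = A'" "{U \<in> A' \<union> B'. U \<subseteq> \<Gamma>} = B'"
    using A'(2) B'(2) by auto
  ultimately show ?thesis
    using A'(3) B'(3) unfolding inf_count_def aff_count_def by (intro exI[of _ "A' \<union> B'"] exI[of _ \<Gamma>]) simp
qed

end
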